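(* Let $R$ be a ring and let $M$ be a left $R$-module which is projective in $\sigma[M]$. If $M$ is co-semisimple and a Goldie module, then $M$ is isomorphic to a finite product of $FI$-simple prime Goldie modules.
   Context: Rings are associative with unit and modules are left unital modules. $\sigma[M]$ is the full subcategory of $R$-Mod of $M$-subgenerated modules (submodules of quotients of direct sums of copies of $M$). "Projective in $\sigma[M]$" means that $\mathrm{Hom}_R(M,-)$ is exact on short exact sequences in $\sigma[M]$. A module $A$ is $M$-injective if every homomorphism from a submodule of $M$ to $A$ extends to $M$. $M$ is co-semisimple if every simple module in $\sigma[M]$ is $M$-injective. For any module $X$: a submodule $N\le X$ is fully invariant, $N\leq_{FI}X$, if $f(N)\le N$ for all $f\in \mathrm{End}_R(X)$; $X$ is $FI$-simple if it has no nonzero proper fully invariant submodules; for $N,K\le X$, the product is $N_XK=\sum\{f(N)\mid f\in \mathrm{Hom}_R(X,K)\}$; a proper submodule $P\leq_{FI}X$ is prime in $X$ if whenever $N,K\leq_{FI}X$ and $N_XK\le P$, then $N\le P$ or $K\le P$; $X$ is a prime module if $0$ is prime in $X$; a left annihilator in $X$ is a submodule of the form $\bigcap_{f\in Y}\mathrm{Ker}(f)$ for some $Y\subseteq \mathrm{End}_R(X)$; $X$ is a Goldie module if it satisfies ACC on left annihilators and has finite uniform dimension. *)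

theory Defs
  imports "HOL-Algebra.Module" "HOL-Algebra.AbelCoset"
begin

section \<open>Left modules over a ring that need not be commutative\<close>

text \<open>
  HOL-Algebra's locale \<open>module\<close> requires a commutative ring of scalars.  The axioms below are the
  same over an arbitrary unital ring, on the same record type; as there, the ring fields \<open>mult\<close> and
  \<open>one\<close> of a module record carry no meaning.  HOL-Algebra's predicate \<open>submodule N R M\<close>
  does not mention commutativity and is used unchanged.  A submodule \<open>N\<close> of \<open>M\<close>, viewed as a
  module, is \<open>M\<lparr>carrier := N\<rparr>\<close>.
\<close>

locale left_module = R?: ring R + M?: abelian_group M
  for R :: "'a ring" (structure) and M :: "('a, 'b) module" (structure) +
  assumes smult_closed [simp, intro]:
      "\<lbrakk>a \<in> carrier R; x \<in> carrier M\<rbrakk> \<Longrightarrow> a \<odot>\<^bsub>M\<^esub> x \<in> carrier M"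
    and smult_l_distr:
      "\<lbrakk>a \<in> carrier R; b \<in> carrier R; x \<in> carrier M\<rbrakk> \<Longrightarrow>
        (a \<oplus>\<^bsub>R\<^esub> b) \<odot>\<^bsub>M\<^esub> x = a \<odot>\<^bsub>M\<^esub> x \<oplus>\<^bsub>M\<^esub> b \<odot>\<^bsub>M\<^esub> x"
    and smult_r_distr:
      "\<lbrakk>a \<in> carrier R; x \<in> carrier M; y \<in> carrier M\<rbrakk> \<Longrightarrow>
        a \<odot>\<^bsub>M\<^esub> (x \<oplus>\<^bsub>M\<^esub> y) = a \<odot>\<^bsub>M\<^esub> x \<oplus>\<^bsub>M\<^esub> a \<odot>\<^bsub>M\<^esub> y"
    and smult_assoc1:
      "\<lbrakk>a \<in> carrier R; b \<in> carrier R; x \<in> carrier M\<rbrakk> \<Longrightarrow>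
        (a \<otimes>\<^bsub>R\<^esub> b) \<odot>\<^bsub>M\<^esub> x = a \<odot>\<^bsub>M\<^esub> (b \<odot>\<^bsub>M\<^esub> x)"
    and smult_one [simp]:
      "x \<in> carrier M \<Longrightarrow> \<one>\<^bsub>R\<^esub> \<odot>\<^bsub>M\<^esub> x = x"

text \<open>Homomorphisms are extensional, so that equal homomorphisms are equal as HOL functions.\<close>

definition lmod_hom :: "'a ring \<Rightarrow> ('a, 'b) module \<Rightarrow> ('a, 'c) module \<Rightarrow> ('b \<Rightarrow> 'c) set" where
  "lmod_hom R M N = {f \<in> carrier M \<rightarrow>\<^sub>E carrier N.
     (\<forall>x\<in>carrier M. \<forall>y\<in>carrier M. f (x \<oplus>\<^bsub>M\<^esub> y) = f x \<oplus>\<^bsub>N\<^esub> f y) \<and>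
     (\<forall>a\<in>carrier R. \<forall>x\<in>carrier M. f (a \<odot>\<^bsub>M\<^esub> x) = a \<odot>\<^bsub>N\<^esub> f x)}"

abbreviation lmod_End :: "'a ring \<Rightarrow> ('a, 'b) module \<Rightarrow> ('b \<Rightarrow> 'b) set" where
  "lmod_End R M \<equiv> lmod_hom R M M"

definition lmod_isomorphic :: "'a ring \<Rightarrow> ('a, 'b) module \<Rightarrow> ('a, 'c) module \<Rightarrow> bool" where
  "lmod_isomorphic R M N \<longleftrightarrow> (\<exists>f \<in> lmod_hom R M N. bij_betw f (carrier M) (carrier N))"

definition submodule_span :: "'a ring \<Rightarrow> ('a, 'b) module \<Rightarrow> 'b set \<Rightarrow> 'b set" where
  "submodule_span R M A = \<Inter>{N. submodule N R M \<and> A \<subseteq> N}"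

definition submodule_sum :: "'a ring \<Rightarrow> ('a, 'b) module \<Rightarrow> 'b set set \<Rightarrow> 'b set" where
  "submodule_sum R M \<N> = submodule_span R M (\<Union>\<N>)"

definition lmod_quotient :: "'a ring \<Rightarrow> ('a, 'b) module \<Rightarrow> 'b set \<Rightarrow> ('a, 'b set) module" where
  "lmod_quotient R M K = \<lparr>carrier = a_rcosets\<^bsub>M\<^esub> K, mult = undefined, one = undefined,
     zero = K, add = (\<lambda>X Y. X <+>\<^bsub>M\<^esub> Y), smult = (\<lambda>a X. \<Union>x\<in>X. K +>\<^bsub>M\<^esub> (a \<odot>\<^bsub>M\<^esub> x))\<rparr>"

definition lmod_product :: "'i set \<Rightarrow> ('i \<Rightarrow> ('a, 'b) module) \<Rightarrow> ('a, 'i \<Rightarrow> 'b) module" where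
  "lmod_product I N = \<lparr>carrier = (\<Pi>\<^sub>E i\<in>I. carrier (N i)), mult = undefined, one = undefined,
     zero = (\<lambda>i\<in>I. \<zero>\<^bsub>N i\<^esub>), add = (\<lambda>f g. \<lambda>i\<in>I. f i \<oplus>\<^bsub>N i\<^esub> g i),
     smult = (\<lambda>a f. \<lambda>i\<in>I. a \<odot>\<^bsub>N i\<^esub> f i)\<rparr>"

definition lmod_direct_sum :: "'i set \<Rightarrow> ('i \<Rightarrow> ('a, 'b) module) \<Rightarrow> ('a, 'i \<Rightarrow> 'b) module" where
  "lmod_direct_sum I N = (lmod_product I N)
     \<lparr>carrier := {f \<in> \<Pi>\<^sub>E i\<in>I. carrier (N i). finite {i \<in> I. f i \<noteq> \<zero>\<^bsub>N i\<^esub>}}\<rparr>"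


section \<open>The category \<open>\<sigma>[M]\<close>, projectivity and co-semisimplicity\<close>

text \<open>
  \<open>N\<close> belongs to \<open>\<sigma>[M]\<close> if it embeds into a quotient of a direct sum of copies of \<open>M\<close>.  Restricting
  the index set to a subset of \<open>nat \<times> 'n\<close>, where \<open>'n\<close> is the element type of \<open>N\<close>, loses nothing:
  given an embedding of \<open>N\<close> into a quotient of \<open>M\<^sup>(\<^sup>I\<^sup>)\<close> with \<open>I\<close> arbitrary, choose a representative in
  \<open>M\<^sup>(\<^sup>I\<^sup>)\<close> of the image of each element of \<open>N\<close>.  Each representative has finite support, so
  \<open>N\<close> already embeds into a quotient of \<open>M\<^sup>(\<^sup>J\<^sup>)\<close> for some \<open>J \<subseteq> I\<close> that injects into \<open>nat \<times> 'n\<close>.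
\<close>

definition in_sigma :: "'a ring \<Rightarrow> ('a, 'm) module \<Rightarrow> ('a, 'n) module \<Rightarrow> bool" where
  "in_sigma R M N \<longleftrightarrow> left_module R N \<and>
     (\<exists>(I :: (nat \<times> 'n) set) K. submodule K R (lmod_direct_sum I (\<lambda>_. M)) \<and>
        (\<exists>e \<in> lmod_hom R N (lmod_quotient R (lmod_direct_sum I (\<lambda>_. M)) K).
           inj_on e (carrier N)))"

definition short_exact ::
  "'a ring \<Rightarrow> ('a, 'b) module \<Rightarrow> ('a, 'c) module \<Rightarrow> ('a, 'd) module \<Rightarrow> ('b \<Rightarrow> 'c) \<Rightarrow> ('c \<Rightarrow> 'd) \<Rightarrow> bool"
  where
  "short_exact R A B C f g \<longleftrightarrow> f \<in> lmod_hom R A B \<and> g \<in> lmod_hom R B C \<and>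
     inj_on f (carrier A) \<and> f ` carrier A = a_kernel B C g \<and> g ` carrier B = carrier C"

text \<open>Exactness of \<open>0 \<rightarrow> Hom(M,A) \<rightarrow> Hom(M,B) \<rightarrow> Hom(M,C) \<rightarrow> 0\<close>, the maps being composition with \<open>f\<close>
  and with \<open>g\<close>.\<close>

definition Hom_exact_on ::
  "'a ring \<Rightarrow> ('a, 'm) module \<Rightarrow> ('a, 'b) module \<Rightarrow> ('a, 'c) module \<Rightarrow> ('a, 'd) module \<Rightarrow>
     ('b \<Rightarrow> 'c) \<Rightarrow> ('c \<Rightarrow> 'd) \<Rightarrow> bool"
  where
  "Hom_exact_on R M A B C f g \<longleftrightarrow>
     inj_on (compose (carrier M) f) (lmod_hom R M A) \<and>
     compose (carrier M) f ` lmod_hom R M A =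
       {h \<in> lmod_hom R M B. compose (carrier M) g h = (\<lambda>x\<in>carrier M. \<zero>\<^bsub>C\<^esub>)} \<and>
     compose (carrier M) g ` lmod_hom R M B = lmod_hom R M C"

text \<open>
  HOL formulas cannot quantify over types, so the modules of \<open>\<sigma>[M]\<close> that occur in the two notions
  below have elements in the fixed type \<open>'m sigma_elt\<close>, of which cosets in \<open>M\<^sup>(\<^sup>I\<^sup>)\<close>,
  \<open>I \<subseteq> nat \<times> 'm\<close>, are elements.  This loses nothing.  By the argument above, every module
  in \<open>\<sigma>[M]\<close> that is generated by at most \<open>|nat \<times> M|\<close> elements is isomorphic to a submodule of a
  quotient of such an \<open>M\<^sup>(\<^sup>I\<^sup>)\<close>, hence to a module on this type.

  Simple modules are cyclic, so all simple modules of \<open>\<sigma>[M]\<close> occur up to isomorphism.  For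
  projectivity, exactness of \<open>Hom(M,-)\<close> on a short exact sequence only fails if some \<open>h : M \<rightarrow> C\<close> does
  not lift along the epimorphism \<open>g : B \<rightarrow> C\<close>.  It then does not lift along the restriction of \<open>g\<close> to
  \<open>B' \<rightarrow> h(M)\<close> either, where \<open>B'\<close> is generated by one preimage under \<open>g\<close> of each element of \<open>h(M)\<close>,
  and \<open>h(M)\<close>, \<open>B'\<close> and the kernel of \<open>B' \<rightarrow> h(M)\<close> all occur up to isomorphism.
\<close>

type_synonym 'm sigma_elt = "(nat \<times> 'm \<Rightarrow> 'm) set"

definition projective_in_sigma :: "'a ring \<Rightarrow> ('a, 'm) module \<Rightarrow> bool" where
  "projective_in_sigma R M \<longleftrightarrow>
     (\<forall>(A :: ('a, 'm sigma_elt) module) (B :: ('a, 'm sigma_elt) module)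
        (C :: ('a, 'm sigma_elt) module) f g.
        in_sigma R M A \<and> in_sigma R M B \<and> in_sigma R M C \<and> short_exact R A B C f g \<longrightarrow>
        Hom_exact_on R M A B C f g)"

definition M_injective :: "'a ring \<Rightarrow> ('a, 'm) module \<Rightarrow> ('a, 'n) module \<Rightarrow> bool" where
  "M_injective R M A \<longleftrightarrow>
     (\<forall>N. submodule N R M \<longrightarrow>
        (\<forall>h \<in> lmod_hom R (M\<lparr>carrier := N\<rparr>) A. \<exists>h' \<in> lmod_hom R M A. \<forall>x\<in>N. h' x = h x))"

definition simple_lmod :: "'a ring \<Rightarrow> ('a, 'n) module \<Rightarrow> bool" where
  "simple_lmod R S \<longleftrightarrow> left_module R S \<and> carrier S \<noteq> {\<zero>\<^bsub>S\<^esub>} \<and>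
     (\<forall>N. submodule N R S \<longrightarrow> N = {\<zero>\<^bsub>S\<^esub>} \<or> N = carrier S)"

definition co_semisimple :: "'a ring \<Rightarrow> ('a, 'm) module \<Rightarrow> bool" where
  "co_semisimple R M \<longleftrightarrow>
     (\<forall>S :: ('a, 'm sigma_elt) module. simple_lmod R S \<and> in_sigma R M S \<longrightarrow> M_injective R M S)"


section \<open>Fully invariant submodules and primeness\<close>

definition fully_invariant :: "'a ring \<Rightarrow> ('a, 'b) module \<Rightarrow> 'b set \<Rightarrow> bool" where
  "fully_invariant R X N \<longleftrightarrow> submodule N R X \<and> (\<forall>f \<in> lmod_End R X. f ` N \<subseteq> N)"

definition FI_simple :: "'a ring \<Rightarrow> ('a, 'b) module \<Rightarrow> bool" where
  "FI_simple R X \<longleftrightarrow> (\<forall>N. fully_invariant R X N \<longrightarrow> N = {\<zero>\<^bsub>X\<^esub>} \<or> N = carrier X)"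

definition submodule_product ::
  "'a ring \<Rightarrow> ('a, 'b) module \<Rightarrow> 'b set \<Rightarrow> 'b set \<Rightarrow> 'b set" where
  "submodule_product R X N K =
     submodule_sum R X {f ` N | f. f \<in> lmod_hom R X (X\<lparr>carrier := K\<rparr>)}"

definition prime_in :: "'a ring \<Rightarrow> ('a, 'b) module \<Rightarrow> 'b set \<Rightarrow> bool" where
  "prime_in R X P \<longleftrightarrow> fully_invariant R X P \<and> P \<noteq> carrier X \<and>
     (\<forall>N K. fully_invariant R X N \<and> fully_invariant R X K \<and> submodule_product R X N K \<subseteq> P \<longrightarrow>
        N \<subseteq> P \<or> K \<subseteq> P)"

definition prime_lmod :: "'a ring \<Rightarrow> ('a, 'b) module \<Rightarrow> bool" where
  "prime_lmod R X \<longleftrightarrow> prime_in R X {\<zero>\<^bsub>X\<^esub>}"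


section \<open>Goldie modules\<close>

definition left_annihilator_in :: "'a ring \<Rightarrow> ('a, 'b) module \<Rightarrow> 'b set \<Rightarrow> bool" where
  "left_annihilator_in R X N \<longleftrightarrow>
     (\<exists>Y \<subseteq> lmod_End R X. N = carrier X \<inter> (\<Inter>f\<in>Y. a_kernel X X f))"

definition ACC_left_annihilators :: "'a ring \<Rightarrow> ('a, 'b) module \<Rightarrow> bool" where
  "ACC_left_annihilators R X \<longleftrightarrow>
     (\<forall>N :: nat \<Rightarrow> 'b set. (\<forall>i. left_annihilator_in R X (N i)) \<and> (\<forall>i. N i \<subseteq> N (Suc i)) \<longrightarrow>
        (\<exists>k. \<forall>i\<ge>k. N i = N k))"

definition essential_in :: "'a ring \<Rightarrow> ('a, 'b) module \<Rightarrow> 'b set \<Rightarrow> bool" where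
  "essential_in R X V \<longleftrightarrow> submodule V R X \<and>
     (\<forall>N. submodule N R X \<and> N \<noteq> {\<zero>\<^bsub>X\<^esub>} \<longrightarrow> V \<inter> N \<noteq> {\<zero>\<^bsub>X\<^esub>})"

definition uniform_submodule :: "'a ring \<Rightarrow> ('a, 'b) module \<Rightarrow> 'b set \<Rightarrow> bool" where
  "uniform_submodule R X U \<longleftrightarrow> submodule U R X \<and> U \<noteq> {\<zero>\<^bsub>X\<^esub>} \<and>
     (\<forall>N K. submodule N R X \<and> submodule K R X \<and> N \<subseteq> U \<and> K \<subseteq> U \<and>
        N \<noteq> {\<zero>\<^bsub>X\<^esub>} \<and> K \<noteq> {\<zero>\<^bsub>X\<^esub>} \<longrightarrow> N \<inter> K \<noteq> {\<zero>\<^bsub>X\<^esub>})"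

definition independent_family :: "'a ring \<Rightarrow> ('a, 'b) module \<Rightarrow> 'i set \<Rightarrow> ('i \<Rightarrow> 'b set) \<Rightarrow> bool" where
  "independent_family R X I U \<longleftrightarrow>
     (\<forall>i\<in>I. U i \<inter> submodule_sum R X (U ` (I - {i})) = {\<zero>\<^bsub>X\<^esub>})"

text \<open>\<open>X\<close> has uniform dimension \<open>n\<close> if some direct sum of \<open>n\<close> uniform submodules is essential in \<open>X\<close>.\<close>

definition has_uniform_dimension :: "'a ring \<Rightarrow> ('a, 'b) module \<Rightarrow> nat \<Rightarrow> bool" where
  "has_uniform_dimension R X n \<longleftrightarrow>
     (\<exists>U :: nat \<Rightarrow> 'b set. (\<forall>i<n. uniform_submodule R X (U i)) \<and>
        independent_family R X {..<n} U \<and> essential_in R X (submodule_sum R X (U ` {..<n})))"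

definition Goldie_lmod :: "'a ring \<Rightarrow> ('a, 'b) module \<Rightarrow> bool" where
  "Goldie_lmod R X \<longleftrightarrow> ACC_left_annihilators R X \<and> (\<exists>n. has_uniform_dimension R X n)"

end

theory Submission
  imports Defs
begin

text \<open>
  Projectivity and co-semisimplicity give \<open>L = L\<^sub>M L\<close> for every submodule \<open>L\<close> of \<open>M\<close>.  With the ACC
  on left annihilators this rules out nonzero submodules \<open>K\<close> such that all \<open>f : M \<rightarrow> K\<close> are
  nilpotent, and finite uniform dimension then yields a monomorphism \<open>c : M \<rightarrow> N\<close> into every
  essential submodule \<open>N\<close>.  If \<open>N\<close> is also fully invariant, \<open>c(M) = c(M)\<^sub>M c(M) \<subseteq> c(N)\<close> forces \<open>N = M\<close>.
  For any fully invariant \<open>N\<close> the sum of \<open>N\<close> and its annihilator \<open>{x. \<forall>f : M \<rightarrow> N. f x = 0}\<close> is direct,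
  essential and fully invariant, so \<open>N\<close> is a direct summand with fully invariant complement.
  Finite uniform dimension lets one split off minimal fully invariant submodules until \<open>M\<close> is
  exhausted.
\<close>

section \<open>Submodules and endomorphisms\<close>

text \<open>The model case is M = R. Endomorphisms are then right multiplications, fully invariant
  submodules are two-sided ideals, the product of submodules is the product of ideals, and the claim
  is that a left V-ring that is left Goldie is a finite product of simple rings. There an essential
  ideal N contains a regular element c, the equation Rc = RcRc gives c = xc with x in N, and
  cancelling c puts 1 into N. For general M a monomorphism M -> N replaces c, and each use of an
  element as a multiplier becomes the lifting of a map M -> f(A) along f : A -> f(A). Projectivity
  supplies these lifts. The obstacle is one of types: projectivity and co-semisimplicity speak about
  modules on one fixed element type, whereas the argument lives on subquotients L/T of M. These are
  therefore copied to that type, and each lift is decoded back to an endomorphism of M.\<close>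

context left_module
begin

lemma smult_l_null [simp]:
  assumes "x \<in> carrier M" shows "\<zero>\<^bsub>R\<^esub> \<odot>\<^bsub>M\<^esub> x = \<zero>\<^bsub>M\<^esub>"
  using smult_l_distr[of "\<zero>\<^bsub>R\<^esub>" "\<zero>\<^bsub>R\<^esub>" x] assms by simp

lemma smult_r_null [simp]:
  assumes "a \<in> carrier R" shows "a \<odot>\<^bsub>M\<^esub> \<zero>\<^bsub>M\<^esub> = \<zero>\<^bsub>M\<^esub>"
  using smult_r_distr[of a "\<zero>\<^bsub>M\<^esub>" "\<zero>\<^bsub>M\<^esub>"] assms by simp

lemma smult_minus_one:
  assumes "x \<in> carrier M" shows "(\<ominus>\<^bsub>R\<^esub> \<one>\<^bsub>R\<^esub>) \<odot>\<^bsub>M\<^esub> x = \<ominus>\<^bsub>M\<^esub> x"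
  using smult_l_distr[of "\<ominus>\<^bsub>R\<^esub> \<one>\<^bsub>R\<^esub>" "\<one>\<^bsub>R\<^esub>" x] assms
  by (simp add: R.l_neg M.minus_equality)

lemma smult_r_minus:
  assumes "a \<in> carrier R" "x \<in> carrier M" shows "a \<odot>\<^bsub>M\<^esub> (\<ominus>\<^bsub>M\<^esub> x) = \<ominus>\<^bsub>M\<^esub> (a \<odot>\<^bsub>M\<^esub> x)"
  using smult_r_distr[of a "\<ominus>\<^bsub>M\<^esub> x" x] assms
  by (metis M.a_inv_closed M.l_neg M.minus_equality smult_closed smult_r_null)

lemma smult_diff:
  assumes "a \<in> carrier R" "x \<in> carrier M" "y \<in> carrier M"
  shows "a \<odot>\<^bsub>M\<^esub> (x \<ominus>\<^bsub>M\<^esub> y) = a \<odot>\<^bsub>M\<^esub> x \<ominus>\<^bsub>M\<^esub> a \<odot>\<^bsub>M\<^esub> y"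
  using assms by (simp add: M.minus_eq smult_r_distr smult_r_minus)

abbreviation sub :: "'b set \<Rightarrow> bool" where
  "sub N \<equiv> submodule N R M"

lemma sub_iff:
  "sub N \<longleftrightarrow> N \<subseteq> carrier M \<and> \<zero>\<^bsub>M\<^esub> \<in> N \<and> (\<forall>x\<in>N. \<forall>y\<in>N. x \<oplus>\<^bsub>M\<^esub> y \<in> N) \<and>
    (\<forall>a\<in>carrier R. \<forall>x\<in>N. a \<odot>\<^bsub>M\<^esub> x \<in> N)" (is "_ \<longleftrightarrow> ?r")
proof
  assume s: "sub N"
  then interpret submodule N R M .
  show ?r using subset one_closed m_closed by auto
next
  assume r: ?r
  have "\<ominus>\<^bsub>M\<^esub> x \<in> N" if "x \<in> N" for x
    using r that smult_minus_one[of x] by (metis R.a_inv_closed R.one_closed subsetD)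
  then have "subgroup N (add_monoid M)"
    using r by (intro subgroup.intro) (auto simp: a_inv_def)
  then show "sub N"
    using r by (simp add: submodule_def submodule_axioms_def)
qed

lemma subI:
  assumes "N \<subseteq> carrier M" "\<zero>\<^bsub>M\<^esub> \<in> N" "\<And>x y. x \<in> N \<Longrightarrow> y \<in> N \<Longrightarrow> x \<oplus>\<^bsub>M\<^esub> y \<in> N"
    "\<And>a x. a \<in> carrier R \<Longrightarrow> x \<in> N \<Longrightarrow> a \<odot>\<^bsub>M\<^esub> x \<in> N"
  shows "sub N"
  using assms by (simp add: sub_iff)

lemma
  assumes "sub N"
  shows sub_carrier: "N \<subseteq> carrier M"
    and sub_mem: "x \<in> N \<Longrightarrow> x \<in> carrier M"
    and sub_zero: "\<zero>\<^bsub>M\<^esub> \<in> N"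
    and sub_add: "x \<in> N \<Longrightarrow> y \<in> N \<Longrightarrow> x \<oplus>\<^bsub>M\<^esub> y \<in> N"
    and sub_smult: "a \<in> carrier R \<Longrightarrow> x \<in> N \<Longrightarrow> a \<odot>\<^bsub>M\<^esub> x \<in> N"
  using assms by (auto simp: sub_iff)

lemma sub_minus:
  assumes "sub N" "x \<in> N" shows "\<ominus>\<^bsub>M\<^esub> x \<in> N"
  using assms smult_minus_one by (metis R.a_inv_closed R.one_closed sub_mem sub_smult)

lemma sub_diff:
  assumes "sub N" "x \<in> N" "y \<in> N" shows "x \<ominus>\<^bsub>M\<^esub> y \<in> N"
  using assms by (simp add: M.minus_eq sub_add sub_minus)

lemma diff_add_cancel: "x \<in> carrier M \<Longrightarrow> y \<in> carrier M \<Longrightarrow> (x \<ominus>\<^bsub>M\<^esub> y) \<oplus>\<^bsub>M\<^esub> y = x"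
  by (simp add: M.minus_eq M.a_assoc M.l_neg)

lemma diff_eq_zero_iff: "x \<in> carrier M \<Longrightarrow> y \<in> carrier M \<Longrightarrow> x \<ominus>\<^bsub>M\<^esub> y = \<zero>\<^bsub>M\<^esub> \<longleftrightarrow> x = y"
  by (metis M.l_zero diff_add_cancel M.minus_eq M.r_neg)

lemma eq_add_iff:
  assumes "x \<in> carrier M" "y \<in> carrier M" "z \<in> carrier M"
  shows "x = y \<oplus>\<^bsub>M\<^esub> z \<longleftrightarrow> z = x \<ominus>\<^bsub>M\<^esub> y"
  using assms by (metis M.a_comm M.add.inv_solve_right' M.minus_eq)

lemma sub_add_cancel_left:
  assumes "sub N" "x \<in> N" "y \<in> carrier M" "x \<oplus>\<^bsub>M\<^esub> y \<in> N" shows "y \<in> N"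
  using assms eq_add_iff[of "x \<oplus>\<^bsub>M\<^esub> y" x y] sub_diff sub_mem by (metis M.a_closed)

lemma sub_add_cancel_right:
  assumes "sub N" "y \<in> N" "x \<in> carrier M" "x \<oplus>\<^bsub>M\<^esub> y \<in> N" shows "x \<in> N"
  using assms sub_add_cancel_left[of N y x] by (metis M.a_comm sub_mem)

lemma sub_full: "sub (carrier M)"
  by (rule subI) auto

lemma sub_trivial: "sub {\<zero>\<^bsub>M\<^esub>}"
  by (rule subI) auto

lemma sub_Int: "sub N \<Longrightarrow> sub K \<Longrightarrow> sub (N \<inter> K)"
  by (auto simp: sub_iff)

lemma sub_nontrivialE:
  assumes "sub N" "N \<noteq> {\<zero>\<^bsub>M\<^esub>}" obtains x where "x \<in> N" "x \<noteq> \<zero>\<^bsub>M\<^esub>"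
  using assms sub_zero by blast

lemma sub_eq_trivialI:
  assumes "sub N" "\<And>x. x \<in> N \<Longrightarrow> x = \<zero>\<^bsub>M\<^esub>" shows "N = {\<zero>\<^bsub>M\<^esub>}"
  using assms sub_zero by blast

lemma Int_trivialD: "A \<inter> B = {\<zero>\<^bsub>M\<^esub>} \<Longrightarrow> x \<in> A \<Longrightarrow> x \<in> B \<Longrightarrow> x = \<zero>\<^bsub>M\<^esub>"
  by blast

lemma mem_set_add_iff: "x \<in> A <+>\<^bsub>M\<^esub> B \<longleftrightarrow> (\<exists>a\<in>A. \<exists>b\<in>B. x = a \<oplus>\<^bsub>M\<^esub> b)"
  by (auto simp: set_add_def')

lemma set_addI: "a \<in> A \<Longrightarrow> b \<in> B \<Longrightarrow> a \<oplus>\<^bsub>M\<^esub> b \<in> A <+>\<^bsub>M\<^esub> B"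
  by (auto simp: mem_set_add_iff)

lemma set_addE:
  assumes "x \<in> A <+>\<^bsub>M\<^esub> B" obtains a b where "a \<in> A" "b \<in> B" "x = a \<oplus>\<^bsub>M\<^esub> b"
  using assms by (auto simp: mem_set_add_iff)

lemma sub_set_add:
  assumes A: "sub A" and B: "sub B" shows "sub (A <+>\<^bsub>M\<^esub> B)"
proof (rule subI)
  show "A <+>\<^bsub>M\<^esub> B \<subseteq> carrier M"
    using sub_mem[OF A] sub_mem[OF B] by (auto simp: mem_set_add_iff)
  show "\<zero>\<^bsub>M\<^esub> \<in> A <+>\<^bsub>M\<^esub> B"
    using sub_zero[OF A] sub_zero[OF B] by (force simp: mem_set_add_iff)
next
  fix x y assume "x \<in> A <+>\<^bsub>M\<^esub> B" "y \<in> A <+>\<^bsub>M\<^esub> B"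
  then obtain a b a' b' where *: "a \<in> A" "b \<in> B" "x = a \<oplus>\<^bsub>M\<^esub> b" "a' \<in> A" "b' \<in> B" "y = a' \<oplus>\<^bsub>M\<^esub> b'"
    by (auto simp: mem_set_add_iff)
  then have "x \<oplus>\<^bsub>M\<^esub> y = (a \<oplus>\<^bsub>M\<^esub> a') \<oplus>\<^bsub>M\<^esub> (b \<oplus>\<^bsub>M\<^esub> b')"
    using sub_mem[OF A] sub_mem[OF B] by (simp add: M.a_ac)
  with * show "x \<oplus>\<^bsub>M\<^esub> y \<in> A <+>\<^bsub>M\<^esub> B"
    by (simp add: set_addI sub_add[OF A] sub_add[OF B])
next
  fix a x assume a: "a \<in> carrier R" and "x \<in> A <+>\<^bsub>M\<^esub> B"
  then obtain u v where *: "u \<in> A" "v \<in> B" "x = u \<oplus>\<^bsub>M\<^esub> v"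
    by (auto simp: mem_set_add_iff)
  then have "a \<odot>\<^bsub>M\<^esub> x = a \<odot>\<^bsub>M\<^esub> u \<oplus>\<^bsub>M\<^esub> a \<odot>\<^bsub>M\<^esub> v"
    using a sub_mem[OF A] sub_mem[OF B] by (simp add: smult_r_distr)
  with * a show "a \<odot>\<^bsub>M\<^esub> x \<in> A <+>\<^bsub>M\<^esub> B"
    by (simp add: set_addI sub_smult[OF A] sub_smult[OF B])
qed

lemma set_add_upper1: assumes "sub A" "sub B" shows "A \<subseteq> A <+>\<^bsub>M\<^esub> B"
  using assms sub_zero[of B] sub_mem[of A] by (force simp: mem_set_add_iff)

lemma set_add_upper2: assumes "sub A" "sub B" shows "B \<subseteq> A <+>\<^bsub>M\<^esub> B"
  using assms sub_zero[of A] sub_mem[of B] by (force simp: mem_set_add_iff)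

lemma set_add_least: assumes "sub C" "A \<subseteq> C" "B \<subseteq> C" shows "A <+>\<^bsub>M\<^esub> B \<subseteq> C"
  using assms sub_add[of C] by (force simp: mem_set_add_iff)

lemma sub_cyclic:
  assumes "x \<in> carrier M" shows "sub ((\<lambda>a. a \<odot>\<^bsub>M\<^esub> x) ` carrier R)"
proof (rule subI)
  show "\<zero>\<^bsub>M\<^esub> \<in> (\<lambda>a. a \<odot>\<^bsub>M\<^esub> x) ` carrier R"
    using assms by (intro image_eqI[of _ _ "\<zero>\<^bsub>R\<^esub>"]) auto
  show "\<And>y z. y \<in> (\<lambda>a. a \<odot>\<^bsub>M\<^esub> x) ` carrier R \<Longrightarrow> z \<in> (\<lambda>a. a \<odot>\<^bsub>M\<^esub> x) ` carrier R \<Longrightarrow>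
      y \<oplus>\<^bsub>M\<^esub> z \<in> (\<lambda>a. a \<odot>\<^bsub>M\<^esub> x) ` carrier R"
    using assms by (auto simp flip: smult_l_distr)
  show "\<And>a y. a \<in> carrier R \<Longrightarrow> y \<in> (\<lambda>a. a \<odot>\<^bsub>M\<^esub> x) ` carrier R \<Longrightarrow>
      a \<odot>\<^bsub>M\<^esub> y \<in> (\<lambda>a. a \<odot>\<^bsub>M\<^esub> x) ` carrier R"
    using assms by (auto simp flip: smult_assoc1)
qed (use assms in auto)

lemma sub_Union_chain:
  assumes "C \<noteq> {}" "\<And>N. N \<in> C \<Longrightarrow> sub N" "\<And>N K. N \<in> C \<Longrightarrow> K \<in> C \<Longrightarrow> N \<subseteq> K \<or> K \<subseteq> N"
  shows "sub (\<Union>C)"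
proof (rule subI)
  fix x y assume "x \<in> \<Union>C" "y \<in> \<Union>C"
  then obtain N K where "N \<in> C" "K \<in> C" "x \<in> N" "y \<in> K" by blast
  then obtain L where "L \<in> C" "x \<in> L" "y \<in> L"
    using assms(3)[of N K] by blast
  then show "x \<oplus>\<^bsub>M\<^esub> y \<in> \<Union>C" using sub_add[OF assms(2)] by blast
qed (use assms(1) sub_zero[OF assms(2)] sub_mem[OF assms(2)] sub_smult[OF assms(2)] in blast)+

lemma sub_span:
  assumes "A \<subseteq> carrier M" shows "sub (submodule_span R M A)"
  using assms sub_full by (auto simp: submodule_span_def sub_iff)

lemma span_superset: "A \<subseteq> submodule_span R M A"
  by (auto simp: submodule_span_def)

lemma span_least: "sub N \<Longrightarrow> A \<subseteq> N \<Longrightarrow> submodule_span R M A \<subseteq> N"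
  by (auto simp: submodule_span_def)

lemma submodule_sum_empty: "submodule_sum R M {} = {\<zero>\<^bsub>M\<^esub>}"
  using span_least[OF sub_trivial, of "{}"] sub_zero[OF sub_span[of "{}"]]
  by (auto simp: submodule_sum_def)

lemma sub_submodule_sum:
  assumes "\<And>N. N \<in> F \<Longrightarrow> sub N" shows "sub (submodule_sum R M F)"
  unfolding submodule_sum_def using sub_carrier[OF assms] by (intro sub_span) blast

lemma submodule_sum_upper: "N \<in> F \<Longrightarrow> N \<subseteq> submodule_sum R M F"
  using span_superset[of "\<Union>F"] by (auto simp: submodule_sum_def)

lemma submodule_sum_least: "sub K \<Longrightarrow> (\<And>N. N \<in> F \<Longrightarrow> N \<subseteq> K) \<Longrightarrow> submodule_sum R M F \<subseteq> K"
  unfolding submodule_sum_def by (rule span_least) auto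

lemma submodule_sum_insert:
  assumes "sub A" "\<And>N. N \<in> F \<Longrightarrow> sub N"
  shows "submodule_sum R M (insert A F) = A <+>\<^bsub>M\<^esub> submodule_sum R M F"
proof
  note F = sub_submodule_sum[OF assms(2), simplified]
  have "sub (submodule_sum R M (insert A F))"
    using assms by (intro sub_submodule_sum) auto
  then show "A <+>\<^bsub>M\<^esub> submodule_sum R M F \<subseteq> submodule_sum R M (insert A F)"
    by (intro set_add_least submodule_sum_least submodule_sum_upper) auto
  show "submodule_sum R M (insert A F) \<subseteq> A <+>\<^bsub>M\<^esub> submodule_sum R M F"
  proof (rule submodule_sum_least)
    show "sub (A <+>\<^bsub>M\<^esub> submodule_sum R M F)" using assms F by (intro sub_set_add)
    fix N assume "N \<in> insert A F"
    then show "N \<subseteq> A <+>\<^bsub>M\<^esub> submodule_sum R M F"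
      using set_add_upper1[OF assms(1) F] set_add_upper2[OF assms(1) F] submodule_sum_upper[of N F]
      by blast
  qed
qed

lemma submodule_sum_mono:
  assumes "F \<subseteq> G" shows "submodule_sum R M F \<subseteq> submodule_sum R M G"
  using assms unfolding submodule_sum_def submodule_span_def by (intro Inter_anti_mono) blast

end

section \<open>Homomorphisms and endomorphisms\<close>

lemma lmod_homI:
  assumes "\<And>x. x \<in> carrier M \<Longrightarrow> f x \<in> carrier N"
    and "\<And>x. x \<notin> carrier M \<Longrightarrow> f x = undefined"
    and "\<And>x y. x \<in> carrier M \<Longrightarrow> y \<in> carrier M \<Longrightarrow> f (x \<oplus>\<^bsub>M\<^esub> y) = f x \<oplus>\<^bsub>N\<^esub> f y"
    and "\<And>a x. a \<in> carrier R \<Longrightarrow> x \<in> carrier M \<Longrightarrow> f (a \<odot>\<^bsub>M\<^esub> x) = a \<odot>\<^bsub>N\<^esub> f x"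
  shows "f \<in> lmod_hom R M N"
  using assms by (auto simp: lmod_hom_def PiE_def extensional_def)

lemma
  assumes "f \<in> lmod_hom R M N"
  shows hom_mem: "x \<in> carrier M \<Longrightarrow> f x \<in> carrier N"
    and hom_add: "x \<in> carrier M \<Longrightarrow> y \<in> carrier M \<Longrightarrow> f (x \<oplus>\<^bsub>M\<^esub> y) = f x \<oplus>\<^bsub>N\<^esub> f y"
    and hom_smult: "a \<in> carrier R \<Longrightarrow> x \<in> carrier M \<Longrightarrow> f (a \<odot>\<^bsub>M\<^esub> x) = a \<odot>\<^bsub>N\<^esub> f x"
  using assms by (auto simp: lmod_hom_def PiE_def extensional_def)

lemma hom_zero:
  assumes "left_module R M" "left_module R N" "f \<in> lmod_hom R M N"
  shows "f \<zero>\<^bsub>M\<^esub> = \<zero>\<^bsub>N\<^esub>"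
proof -
  interpret M: left_module R M by fact
  interpret N: left_module R N by fact
  show ?thesis
    using hom_smult[OF assms(3), of "\<zero>\<^bsub>R\<^esub>" "\<zero>\<^bsub>M\<^esub>"] hom_mem[OF assms(3)] by simp
qed

lemma hom_diff:
  assumes "left_module R M" "left_module R N" "f \<in> lmod_hom R M N" "x \<in> carrier M" "y \<in> carrier M"
  shows "f (x \<ominus>\<^bsub>M\<^esub> y) = f x \<ominus>\<^bsub>N\<^esub> f y"
proof -
  interpret M: left_module R M by fact
  interpret N: left_module R N by fact
  have "f (\<ominus>\<^bsub>M\<^esub> y) = \<ominus>\<^bsub>N\<^esub> f y"
    using hom_smult[OF assms(3), of "\<ominus>\<^bsub>R\<^esub> \<one>\<^bsub>R\<^esub>" y] hom_mem[OF assms(3)] assms(5)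
    by (simp add: M.smult_minus_one N.smult_minus_one)
  then show ?thesis
    using assms by (simp add: M.M.minus_eq N.M.minus_eq hom_add)
qed

lemma hom_compose:
  assumes "left_module R M" "f \<in> lmod_hom R M N" "g \<in> lmod_hom R N K"
  shows "compose (carrier M) g f \<in> lmod_hom R M K"
proof -
  interpret left_module R M by fact
  show ?thesis
    using assms(2,3) by (auto simp: lmod_hom_def compose_def extensional_def PiE_def Pi_def)
qed

context left_module
begin

abbreviation E :: "('b \<Rightarrow> 'b) set" where
  "E \<equiv> lmod_End R M"

lemma is_left_module: "left_module R M" ..

lemmas E_mem = hom_mem[of _ R M M] and E_add = hom_add[of _ R M M]
  and E_smult = hom_smult[of _ R M M]
lemmas E_zero = hom_zero[OF is_left_module is_left_module]
  and E_diff = hom_diff[OF is_left_module is_left_module]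

lemma submodule_left_module:
  assumes "sub N" shows "left_module R (M\<lparr>carrier := N\<rparr>)"
proof -
  have "abelian_group (M\<lparr>carrier := N\<rparr>)"
  proof (rule abelian_groupI)
    show "\<exists>y\<in>carrier (M\<lparr>carrier := N\<rparr>). y \<oplus>\<^bsub>M\<lparr>carrier := N\<rparr>\<^esub> x = \<zero>\<^bsub>M\<lparr>carrier := N\<rparr>\<^esub>"
      if "x \<in> carrier (M\<lparr>carrier := N\<rparr>)" for x
      using that sub_minus[OF assms, of x] sub_mem[OF assms] M.l_neg by auto
  qed (use sub_mem[OF assms] sub_add[OF assms] sub_zero[OF assms] in \<open>auto simp: M.a_ac\<close>)
  then show ?thesis
    using sub_mem[OF assms] sub_smult[OF assms] R.ring_axioms
    by (auto simp: left_module_def left_module_axioms_def smult_l_distr smult_r_distr smult_assoc1)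
qed

lemma submodule_submodule_iff:
  assumes "sub N" shows "submodule K R (M\<lparr>carrier := N\<rparr>) \<longleftrightarrow> sub K \<and> K \<subseteq> N"
proof -
  interpret N: left_module R "M\<lparr>carrier := N\<rparr>" by (rule submodule_left_module[OF assms])
  show ?thesis using sub_carrier[OF assms] by (auto simp: N.sub_iff sub_iff)
qed

text \<open>Extensionality concerns only the domain, so a map into the submodule is literally the
  same function as an endomorphism with image in N. This is why maps M -> N appear throughout as
  elements of \<open>E\<close> with a condition on the image.\<close>

lemma hom_to_submodule_iff:
  assumes "sub N" shows "f \<in> lmod_hom R M (M\<lparr>carrier := N\<rparr>) \<longleftrightarrow> f \<in> E \<and> f ` carrier M \<subseteq> N"
  using sub_carrier[OF assms] by (auto simp: lmod_hom_def PiE_def Pi_def)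

lemma E_compose: "f \<in> E \<Longrightarrow> g \<in> E \<Longrightarrow> compose (carrier M) f g \<in> E"
  by (rule hom_compose[OF is_left_module])

lemma E_sum: "f \<in> E \<Longrightarrow> g \<in> E \<Longrightarrow> (\<lambda>x\<in>carrier M. f x \<oplus>\<^bsub>M\<^esub> g x) \<in> E"
  by (rule lmod_homI) (auto simp: E_mem E_add E_smult M.a_ac smult_r_distr)

lemma E_null: "(\<lambda>x\<in>carrier M. \<zero>\<^bsub>M\<^esub>) \<in> E"
  by (rule lmod_homI) auto

lemma sub_image:
  assumes "f \<in> E" "sub N" shows "sub (f ` N)"
proof (rule subI)
  note m = sub_mem[OF assms(2)]
  show "f ` N \<subseteq> carrier M" using E_mem[OF assms(1)] m by auto
  show "\<zero>\<^bsub>M\<^esub> \<in> f ` N" using E_zero[OF assms(1)] sub_zero[OF assms(2)] by force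
  show "\<And>x y. x \<in> f ` N \<Longrightarrow> y \<in> f ` N \<Longrightarrow> x \<oplus>\<^bsub>M\<^esub> y \<in> f ` N"
    using m sub_add[OF assms(2)] by (auto simp: E_add[OF assms(1), symmetric])
  show "\<And>a x. a \<in> carrier R \<Longrightarrow> x \<in> f ` N \<Longrightarrow> a \<odot>\<^bsub>M\<^esub> x \<in> f ` N"
    using m sub_smult[OF assms(2)] by (auto simp: E_smult[OF assms(1), symmetric])
qed

lemma sub_vimage:
  assumes "f \<in> E" "sub N" shows "sub {x \<in> carrier M. f x \<in> N}"
  using sub_zero[OF assms(2)] sub_add[OF assms(2)] sub_smult[OF assms(2)]
  by (intro subI) (auto simp: E_zero[OF assms(1)] E_add[OF assms(1)] E_smult[OF assms(1)])

lemma mem_kernel_iff: "x \<in> a_kernel M N f \<longleftrightarrow> x \<in> carrier M \<and> f x = \<zero>\<^bsub>N\<^esub>"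
  by (simp add: a_kernel_def')

lemma sub_kernel: "f \<in> E \<Longrightarrow> sub (a_kernel M M f)"
  using sub_vimage[OF _ sub_trivial, of f] by (simp add: a_kernel_def')

end

section \<open>Subquotients in \<open>\<sigma>[M]\<close>\<close>

lemma left_module_product:
  fixes R :: "'a ring" and N :: "'i \<Rightarrow> ('a, 'b) module"
  assumes "ring R" "\<And>i. i \<in> I \<Longrightarrow> left_module R (N i)"
  shows "left_module R (lmod_product I N)"
proof -
  note N = assms(2)
  have ab: "abelian_group (N i)" if "i \<in> I" for i
    using N[OF that] by (simp add: left_module_def)
  note mon = abelian_group.axioms(1)[OF ab]
  have "abelian_group (lmod_product I N)"
  proof (rule abelian_groupI)
    fix x assume x: "x \<in> carrier (lmod_product I N)"
    then have x': "x i \<in> carrier (N i)" if "i \<in> I" for i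
      using that by (auto simp: lmod_product_def)
    have "(\<lambda>i\<in>I. \<ominus>\<^bsub>N i\<^esub> x i) \<in> carrier (lmod_product I N)"
      using x' abelian_group.a_inv_closed[OF ab] by (auto simp: lmod_product_def)
    moreover have "(\<lambda>i\<in>I. \<ominus>\<^bsub>N i\<^esub> x i) \<oplus>\<^bsub>lmod_product I N\<^esub> x = \<zero>\<^bsub>lmod_product I N\<^esub>"
      using x' abelian_group.l_neg[OF ab] by (auto simp: lmod_product_def fun_eq_iff)
    ultimately show "\<exists>y\<in>carrier (lmod_product I N). y \<oplus>\<^bsub>lmod_product I N\<^esub> x = \<zero>\<^bsub>lmod_product I N\<^esub>"
      by blast
  qed (auto simp: lmod_product_def fun_eq_iff PiE_def Pi_def extensional_def
      abelian_monoid.a_closed[OF mon] abelian_monoid.zero_closed[OF mon]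
      abelian_monoid.a_assoc[OF mon] abelian_monoid.a_comm[OF mon] abelian_monoid.a_lcomm[OF mon] abelian_monoid.l_zero[OF mon]
      abelian_monoid.r_zero[OF mon])
  moreover have "left_module_axioms R (lmod_product I N)"
    using left_module.smult_closed[OF N] left_module.smult_l_distr[OF N]
      left_module.smult_r_distr[OF N] left_module.smult_assoc1[OF N] left_module.smult_one[OF N]
    by unfold_locales (auto simp: lmod_product_def fun_eq_iff PiE_def Pi_def extensional_def)
  ultimately show ?thesis
    using assms(1) by (simp add: left_module_def)
qed

lemma lmod_direct_sum_finite:
  assumes "finite I" shows "lmod_direct_sum I N = lmod_product I N"
  using assms by (simp add: lmod_direct_sum_def lmod_product_def)

text \<open>A quotient of L with carrier q(L), so that it can live on any prescribed type. The
  target of q carries no operations; addition and scalar multiplication are computed on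
  representatives picked by \<open>inv_into\<close>.\<close>

definition image_module :: "('a, 'b) module \<Rightarrow> 'b set \<Rightarrow> ('b \<Rightarrow> 'c) \<Rightarrow> ('a, 'c) module" where
  "image_module M L q = \<lparr>carrier = q ` L, mult = undefined, one = undefined, zero = q \<zero>\<^bsub>M\<^esub>,
     add = (\<lambda>X Y. q (inv_into L q X \<oplus>\<^bsub>M\<^esub> inv_into L q Y)),
     smult = (\<lambda>a X. q (a \<odot>\<^bsub>M\<^esub> inv_into L q X))\<rparr>"

text \<open>A coset is coded by the constant functions with values in it, to obtain an element of type
  \<open>'m sigma_elt\<close>.\<close>

definition sigma_code :: "('a, 'm) module \<Rightarrow> 'm set \<Rightarrow> 'm \<Rightarrow> 'm sigma_elt" where
  "sigma_code M T x = (\<lambda>y _. y) ` (T +>\<^bsub>M\<^esub> x)"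

section \<open>Cosets and copies of subquotients L/T\<close>

context left_module
begin

lemma mem_rcos_iff:
  assumes "sub T" "x \<in> carrier M"
  shows "z \<in> T +>\<^bsub>M\<^esub> x \<longleftrightarrow> z \<in> carrier M \<and> z \<ominus>\<^bsub>M\<^esub> x \<in> T"
proof
  assume "z \<in> T +>\<^bsub>M\<^esub> x"
  then obtain t where t: "t \<in> T" "z = t \<oplus>\<^bsub>M\<^esub> x" by (auto simp: a_r_coset_def')
  then show "z \<in> carrier M \<and> z \<ominus>\<^bsub>M\<^esub> x \<in> T"
    using eq_add_iff[of z x t] assms sub_mem[OF assms(1)] by (auto simp: M.a_comm)
next
  assume z: "z \<in> carrier M \<and> z \<ominus>\<^bsub>M\<^esub> x \<in> T"
  then have "z = (z \<ominus>\<^bsub>M\<^esub> x) \<oplus>\<^bsub>M\<^esub> x" using assms by (simp add: diff_add_cancel)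
  with z show "z \<in> T +>\<^bsub>M\<^esub> x" unfolding a_r_coset_def' by blast
qed

lemma diff_trans:
  assumes "x \<in> carrier M" "y \<in> carrier M" "z \<in> carrier M"
  shows "(x \<ominus>\<^bsub>M\<^esub> y) \<oplus>\<^bsub>M\<^esub> (y \<ominus>\<^bsub>M\<^esub> z) = x \<ominus>\<^bsub>M\<^esub> z"
  using assms diff_add_cancel[of x y]
  by (simp add: M.minus_eq M.add.m_assoc[symmetric])

lemma diff_zero: "x \<in> carrier M \<Longrightarrow> x \<ominus>\<^bsub>M\<^esub> \<zero>\<^bsub>M\<^esub> = x"
  using diff_add_cancel[of x "\<zero>\<^bsub>M\<^esub>"] by simp

lemma sub_diff_sym: "sub T \<Longrightarrow> x \<in> carrier M \<Longrightarrow> y \<in> carrier M \<Longrightarrow> x \<ominus>\<^bsub>M\<^esub> y \<in> T \<Longrightarrow> y \<ominus>\<^bsub>M\<^esub> x \<in> T"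
  using sub_minus[of T "x \<ominus>\<^bsub>M\<^esub> y"] by (simp add: M.minus_eq M.minus_add M.a_comm)

lemma rcos_eq_iff:
  assumes "sub T" "x \<in> carrier M" "y \<in> carrier M"
  shows "T +>\<^bsub>M\<^esub> x = T +>\<^bsub>M\<^esub> y \<longleftrightarrow> x \<ominus>\<^bsub>M\<^esub> y \<in> T"
proof
  have "x \<in> T +>\<^bsub>M\<^esub> x"
    using assms sub_zero by (simp add: mem_rcos_iff diff_eq_zero_iff[THEN iffD2])
  moreover assume "T +>\<^bsub>M\<^esub> x = T +>\<^bsub>M\<^esub> y"
  ultimately show "x \<ominus>\<^bsub>M\<^esub> y \<in> T" using assms by (simp add: mem_rcos_iff)
next
  assume *: "x \<ominus>\<^bsub>M\<^esub> y \<in> T"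
  have "z \<ominus>\<^bsub>M\<^esub> x \<in> T \<longleftrightarrow> z \<ominus>\<^bsub>M\<^esub> y \<in> T" if "z \<in> carrier M" for z
    using assms that * sub_diff_sym[OF assms(1-3) *] sub_add[OF assms(1)]
      diff_trans[of z x y] diff_trans[of z y x] by metis
  then show "T +>\<^bsub>M\<^esub> x = T +>\<^bsub>M\<^esub> y"
    using assms by (auto simp: mem_rcos_iff)
qed

lemma abelian_subgroup_sub: "sub T \<Longrightarrow> abelian_subgroup T M"
  by (intro abelian_subgroupI3 additive_subgroupI submodule.axioms(1) M.abelian_group_axioms)

lemma
  assumes "sub K"
  shows lmod_quotient_carrier: "x \<in> carrier M \<Longrightarrow> K +>\<^bsub>M\<^esub> x \<in> carrier (lmod_quotient R M K)"
    and lmod_quotient_add: "x \<in> carrier M \<Longrightarrow> y \<in> carrier M \<Longrightarrow>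
      (K +>\<^bsub>M\<^esub> x) \<oplus>\<^bsub>lmod_quotient R M K\<^esub> (K +>\<^bsub>M\<^esub> y) = K +>\<^bsub>M\<^esub> (x \<oplus>\<^bsub>M\<^esub> y)"
    and lmod_quotient_smult: "a \<in> carrier R \<Longrightarrow> x \<in> carrier M \<Longrightarrow>
      a \<odot>\<^bsub>lmod_quotient R M K\<^esub> (K +>\<^bsub>M\<^esub> x) = K +>\<^bsub>M\<^esub> (a \<odot>\<^bsub>M\<^esub> x)"
proof -
  show "x \<in> carrier M \<Longrightarrow> K +>\<^bsub>M\<^esub> x \<in> carrier (lmod_quotient R M K)"
    by (auto simp: lmod_quotient_def A_RCOSETS_def')
  show "x \<in> carrier M \<Longrightarrow> y \<in> carrier M \<Longrightarrow>
      (K +>\<^bsub>M\<^esub> x) \<oplus>\<^bsub>lmod_quotient R M K\<^esub> (K +>\<^bsub>M\<^esub> y) = K +>\<^bsub>M\<^esub> (x \<oplus>\<^bsub>M\<^esub> y)"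
    using abelian_subgroup.a_rcos_sum[OF abelian_subgroup_sub[OF assms]]
    by (simp add: lmod_quotient_def)
  assume a: "a \<in> carrier R" and x: "x \<in> carrier M"
  \<comment> \<open>Scalar multiplication in \<open>lmod_quotient\<close> is a union over the
    members of a coset, so all the cosets in that union have to coincide.\<close>
  have const: "K +>\<^bsub>M\<^esub> (a \<odot>\<^bsub>M\<^esub> y) = K +>\<^bsub>M\<^esub> (a \<odot>\<^bsub>M\<^esub> x)" if "y \<in> K +>\<^bsub>M\<^esub> x" for y
  proof -
    have y: "y \<in> carrier M" "y \<ominus>\<^bsub>M\<^esub> x \<in> K" using that assms x by (auto simp: mem_rcos_iff)
    then show ?thesis
      using assms a x sub_smult[OF assms a y(2)] by (simp add: rcos_eq_iff smult_diff)
  qed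
  have "x \<in> K +>\<^bsub>M\<^esub> x"
    using assms x sub_zero by (simp add: mem_rcos_iff diff_eq_zero_iff[THEN iffD2])
  then have "K +>\<^bsub>M\<^esub> x \<noteq> {}" by blast
  from SUP_eq_const[OF this const]
  show "a \<odot>\<^bsub>lmod_quotient R M K\<^esub> (K +>\<^bsub>M\<^esub> x) = K +>\<^bsub>M\<^esub> (a \<odot>\<^bsub>M\<^esub> x)"
    by (simp only: lmod_quotient_def module.simps)
qed

text \<open>Under this condition \<open>image_module M L q\<close> is a copy of L/(L \<inter> T),
  and T = 0 yields a copy of L itself. Linearity of q is not asked for, because the operations on
  q(L) are transported from L.\<close>

definition quotient_map :: "'b set \<Rightarrow> 'b set \<Rightarrow> ('b \<Rightarrow> 'c) \<Rightarrow> bool" where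
  "quotient_map L T q \<longleftrightarrow> sub L \<and> sub T \<and> (\<forall>x\<in>L. \<forall>y\<in>L. q x = q y \<longleftrightarrow> x \<ominus>\<^bsub>M\<^esub> y \<in> T)"

context
  fixes L T :: "'b set" and q :: "'b \<Rightarrow> 'c"
  assumes q: "quotient_map L T q"
begin

lemma quotient_map_sub: "sub L" "sub T"
  using q by (auto simp: quotient_map_def)

lemma quotient_map_eq_iff: "x \<in> L \<Longrightarrow> y \<in> L \<Longrightarrow> q x = q y \<longleftrightarrow> x \<ominus>\<^bsub>M\<^esub> y \<in> T"
  using q by (auto simp: quotient_map_def)

lemma quotient_map_zero_iff: "x \<in> L \<Longrightarrow> q x = q \<zero>\<^bsub>M\<^esub> \<longleftrightarrow> x \<in> T"
  using quotient_map_eq_iff[of x "\<zero>\<^bsub>M\<^esub>"] sub_zero[OF quotient_map_sub(1)]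
    sub_mem[OF quotient_map_sub(1)] by (simp add: diff_zero)

lemma quotient_map_rep:
  assumes "x \<in> L" shows "inv_into L q (q x) \<in> L" "inv_into L q (q x) \<ominus>\<^bsub>M\<^esub> x \<in> T"
proof -
  show 1: "inv_into L q (q x) \<in> L" using assms by (intro inv_into_into) auto
  have "q (inv_into L q (q x)) = q x" using assms by (intro f_inv_into_f) auto
  then show "inv_into L q (q x) \<ominus>\<^bsub>M\<^esub> x \<in> T" using quotient_map_eq_iff[OF 1 assms] by simp
qed

lemma image_module_carrier: "carrier (image_module M L q) = q ` L"
  by (simp add: image_module_def)

lemma image_module_zero: "\<zero>\<^bsub>image_module M L q\<^esub> = q \<zero>\<^bsub>M\<^esub>"
  by (simp add: image_module_def)

lemma image_module_add:
  assumes "x \<in> L" "y \<in> L" shows "q x \<oplus>\<^bsub>image_module M L q\<^esub> q y = q (x \<oplus>\<^bsub>M\<^esub> y)"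
proof -
  let ?x = "inv_into L q (q x)" and ?y = "inv_into L q (q y)"
  note m = sub_mem[OF quotient_map_sub(1)] and rx = quotient_map_rep[OF assms(1)]
    and ry = quotient_map_rep[OF assms(2)]
  have "(?x \<ominus>\<^bsub>M\<^esub> x) \<oplus>\<^bsub>M\<^esub> (?y \<ominus>\<^bsub>M\<^esub> y) = (?x \<oplus>\<^bsub>M\<^esub> ?y) \<ominus>\<^bsub>M\<^esub> (x \<oplus>\<^bsub>M\<^esub> y)"
    using m[OF rx(1)] m[OF ry(1)] m[OF assms(1)] m[OF assms(2)]
    by (simp add: M.minus_eq M.minus_add M.a_ac)
  then have "(?x \<oplus>\<^bsub>M\<^esub> ?y) \<ominus>\<^bsub>M\<^esub> (x \<oplus>\<^bsub>M\<^esub> y) \<in> T"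
    using sub_add[OF quotient_map_sub(2) rx(2) ry(2)] by simp
  then show ?thesis
    using rx(1) ry(1) assms sub_add[OF quotient_map_sub(1)]
    by (simp add: image_module_def quotient_map_eq_iff)
qed

lemma image_module_smult:
  assumes "a \<in> carrier R" "x \<in> L" shows "a \<odot>\<^bsub>image_module M L q\<^esub> q x = q (a \<odot>\<^bsub>M\<^esub> x)"
proof -
  note r = quotient_map_rep[OF assms(2)] and m = sub_mem[OF quotient_map_sub(1)]
  have "a \<odot>\<^bsub>M\<^esub> inv_into L q (q x) \<ominus>\<^bsub>M\<^esub> a \<odot>\<^bsub>M\<^esub> x \<in> T"
    using sub_smult[OF quotient_map_sub(2) assms(1) r(2)] m[OF r(1)] m[OF assms(2)] assms(1)
    by (simp add: smult_diff)
  then show ?thesis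
    using r(1) assms sub_smult[OF quotient_map_sub(1)]
    by (simp add: image_module_def quotient_map_eq_iff)
qed

lemmas image_module_simps = image_module_carrier image_module_zero image_module_add
  image_module_smult

lemma image_module_left_module: "left_module R (image_module M L q)"
proof -
  note L = quotient_map_sub(1)
  note m = sub_mem[OF L] sub_add[OF L] sub_smult[OF L] sub_zero[OF L] sub_minus[OF L]
  have "abelian_group (image_module M L q)"
  proof (rule abelian_groupI)
    fix X assume "X \<in> carrier (image_module M L q)"
    then obtain x where x: "x \<in> L" "X = q x" by (auto simp: image_module_carrier)
    then have "q (\<ominus>\<^bsub>M\<^esub> x) \<oplus>\<^bsub>image_module M L q\<^esub> X = \<zero>\<^bsub>image_module M L q\<^esub>"
      by (simp add: image_module_simps m M.l_neg)
    then show "\<exists>Y\<in>carrier (image_module M L q). Y \<oplus>\<^bsub>image_module M L q\<^esub> X = \<zero>\<^bsub>image_module M L q\<^esub>"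
      using x m by (auto simp: image_module_carrier)
  qed (auto simp: image_module_simps m M.a_ac)
  moreover have "left_module_axioms R (image_module M L q)"
    by unfold_locales
      (auto simp: image_module_simps m smult_l_distr smult_r_distr smult_assoc1)
  ultimately show ?thesis using R.ring_axioms by (simp add: left_module_def)
qed

text \<open>Because L lies in M, the class of x goes to the coset of x in M/T, and M/T is a quotient
  of a direct sum with a single summand. Any one-element index set serves; \<open>undefined\<close>
  merely names an element of the index type.\<close>

lemma image_module_in_sigma: "in_sigma R M (image_module M L q)"
proof -
  let ?Q = "image_module M L q"
  define I :: "(nat \<times> 'c) set" where "I = {undefined}"
  define D where "D = lmod_direct_sum I (\<lambda>_. M)"
  have D_prod: "D = lmod_product I (\<lambda>_. M)"
    unfolding D_def by (rule lmod_direct_sum_finite) (simp add: I_def)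
  interpret D: left_module R D
    unfolding D_prod by (rule left_module_product) (rule R.ring_axioms, rule is_left_module)
  define \<iota> where "\<iota> x = (\<lambda>i\<in>I. x)" for x :: 'b
  have \<iota>: "x \<in> carrier M \<Longrightarrow> \<iota> x \<in> carrier D" "\<iota> x \<oplus>\<^bsub>D\<^esub> \<iota> y = \<iota> (x \<oplus>\<^bsub>M\<^esub> y)"
    "a \<odot>\<^bsub>D\<^esub> \<iota> x = \<iota> (a \<odot>\<^bsub>M\<^esub> x)" for a x y
    by (auto simp: D_prod lmod_product_def \<iota>_def fun_eq_iff)
  have \<iota>_inj: "\<iota> x = \<iota> y \<Longrightarrow> x = y" for x y
    unfolding \<iota>_def I_def by (drule fun_cong[of _ _ undefined]) simp
  have \<iota>_zero: "\<iota> \<zero>\<^bsub>M\<^esub> = \<zero>\<^bsub>D\<^esub>"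
    by (simp add: D_prod lmod_product_def \<iota>_def)
  have \<iota>_diff: "\<iota> x \<ominus>\<^bsub>D\<^esub> \<iota> y = \<iota> (x \<ominus>\<^bsub>M\<^esub> y)" if "x \<in> carrier M" "y \<in> carrier M" for x y
    using \<iota>(1)[of x] \<iota>(1)[of y] \<iota>(1)[of "x \<ominus>\<^bsub>M\<^esub> y"] \<iota>(2)[of y "x \<ominus>\<^bsub>M\<^esub> y"] that
      D.eq_add_iff[of "\<iota> x" "\<iota> y" "\<iota> (x \<ominus>\<^bsub>M\<^esub> y)"] eq_add_iff[of x y "x \<ominus>\<^bsub>M\<^esub> y"]
    by simp
  note L = quotient_map_sub(1) and T = quotient_map_sub(2)
  note m = sub_mem[OF L] and mT = sub_mem[OF T]
  have K: "D.sub (\<iota> ` T)"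
    using mT sub_zero[OF T] sub_add[OF T] sub_smult[OF T]
    by (intro D.subI) (auto simp: \<iota> simp flip: \<iota>_zero)
  define e where "e = (\<lambda>X\<in>q ` L. \<iota> ` T +>\<^bsub>D\<^esub> \<iota> (inv_into L q X))"
  have eq: "\<iota> ` T +>\<^bsub>D\<^esub> \<iota> x = \<iota> ` T +>\<^bsub>D\<^esub> \<iota> y \<longleftrightarrow> x \<ominus>\<^bsub>M\<^esub> y \<in> T" if "x \<in> L" "y \<in> L" for x y
    using that m \<iota>_inj by (auto simp: D.rcos_eq_iff[OF K] \<iota> \<iota>_diff)
  have e: "e (q x) = \<iota> ` T +>\<^bsub>D\<^esub> \<iota> x" if "x \<in> L" for x
    using that quotient_map_rep[OF that] by (simp add: e_def eq)
  have e_undefined: "e X = undefined" if "X \<notin> q ` L" for X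
    using that by (simp add: e_def)
  have "e \<in> lmod_hom R ?Q (lmod_quotient R D (\<iota> ` T))"
    by (rule lmod_homI)
      (use m sub_add[OF L] sub_smult[OF L] in
        \<open>auto simp: image_module_simps e \<iota> D.lmod_quotient_carrier[OF K] e_undefined
          D.lmod_quotient_add[OF K] D.lmod_quotient_smult[OF K]\<close>)
  moreover have "inj_on e (carrier ?Q)"
    by (auto simp: inj_on_def image_module_carrier e eq quotient_map_eq_iff)
  ultimately show ?thesis
    using K image_module_left_module unfolding in_sigma_def D_def by blast
qed

end

text \<open>The canonical map is well defined because T \<subseteq> T'. It provides both the
  inclusion of T into L (with zero submodules below) and the projection of L onto L/T.\<close>

lemma image_module_hom:
  assumes p: "quotient_map L T p" and q: "quotient_map L' T' q" and "L \<subseteq> L'" "T \<subseteq> T'"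
  obtains g where "g \<in> lmod_hom R (image_module M L p) (image_module M L' q)"
    "\<And>x. x \<in> L \<Longrightarrow> g (p x) = q x"
proof -
  define g where "g = (\<lambda>X\<in>p ` L. q (inv_into L p X))"
  have g: "g (p x) = q x" if "x \<in> L" for x
    using that quotient_map_rep[OF p that] assms(3,4)
    by (simp add: g_def) (subst quotient_map_eq_iff[OF q], auto)
  have g_undefined: "g X = undefined" if "X \<notin> p ` L" for X
    using that by (simp add: g_def)
  note L = quotient_map_sub(1)[OF p]
  have "g \<in> lmod_hom R (image_module M L p) (image_module M L' q)"
    by (rule lmod_homI)
      (use assms(3) sub_add[OF L] sub_smult[OF L] in
        \<open>auto simp: image_module_simps[OF p] image_module_simps[OF q] g g_undefined
          subsetD[OF \<open>L \<subseteq> L'\<close>]\<close>)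
  with g that show ?thesis by blast
qed

lemma quotient_map_sigma_code:
  assumes "sub L" "sub T" shows "quotient_map L T (sigma_code M T)"
proof -
  have inj: "inj (\<lambda>(y::'b) (_ :: nat \<times> 'b). y)"
    by (auto simp: inj_def fun_eq_iff)
  show ?thesis
    using assms sub_mem[OF assms(1)]
    by (auto simp: quotient_map_def sigma_code_def inj_image_eq_iff[OF inj] rcos_eq_iff)
qed

text \<open>Exactness of Hom(M,-) on 0 -> T -> L -> L/T -> 0, applied to h : M -> L/T. All three
  terms must live on the coded type, so T and L enter as their own quotients by 0.\<close>

lemma projective_lift:
  assumes proj: "projective_in_sigma R M" and L: "sub L" and T: "sub T" and "T \<subseteq> L"
    and h: "h \<in> lmod_hom R M (image_module M L (sigma_code M T))"
  obtains f where "f \<in> E" "f ` carrier M \<subseteq> L" "\<And>x. x \<in> carrier M \<Longrightarrow> sigma_code M T (f x) = h x"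
proof -
  let ?p = "sigma_code M {\<zero>\<^bsub>M\<^esub>}" and ?q = "sigma_code M T"
  let ?A = "image_module M T ?p" and ?B = "image_module M L ?p" and ?C = "image_module M L ?q"
  note qA = quotient_map_sigma_code[OF T sub_trivial]
    and qB = quotient_map_sigma_code[OF L sub_trivial] and qC = quotient_map_sigma_code[OF L T]
  obtain i where i: "i \<in> lmod_hom R ?A ?B" "\<And>x. x \<in> T \<Longrightarrow> i (?p x) = ?p x"
    using image_module_hom[OF qA qB \<open>T \<subseteq> L\<close>] by blast
  obtain g where g: "g \<in> lmod_hom R ?B ?C" "\<And>x. x \<in> L \<Longrightarrow> g (?p x) = ?q x"
    using image_module_hom[OF qB qC] sub_zero[OF T] by blast
  have "i ` carrier ?A = ?p ` T"
    using i(2) by (force simp: image_module_carrier[OF qA])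
  also have "\<dots> = a_kernel ?B ?C g"
    unfolding a_kernel_def' image_module_carrier[OF qB] image_module_zero[OF qC]
    using g(2) \<open>T \<subseteq> L\<close> quotient_map_zero_iff[OF qC] by blast
  finally have "i ` carrier ?A = a_kernel ?B ?C g" .
  moreover have "inj_on i (carrier ?A)"
    using i(2) by (auto simp: inj_on_def image_module_carrier[OF qA])
  moreover have "g ` carrier ?B = carrier ?C"
    using g(2) by (force simp: image_module_carrier[OF qB] image_module_carrier[OF qC])
  ultimately have "short_exact R ?A ?B ?C i g"
    using i(1) g(1) by (simp add: short_exact_def)
  then have exact: "Hom_exact_on R M ?A ?B ?C i g"
    using proj image_module_in_sigma[OF qA] image_module_in_sigma[OF qB]
      image_module_in_sigma[OF qC]
    unfolding projective_in_sigma_def by blast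
  have "h \<in> compose (carrier M) g ` lmod_hom R M ?B"
    using exact h by (simp add: Hom_exact_on_def)
  then obtain k where k: "k \<in> lmod_hom R M ?B" "compose (carrier M) g k = h"
    by (auto simp only: image_iff)
  \<comment> \<open>The lift k has values in the coded copy of L. Decoding it keeps linearity
    because \<open>?p\<close> is injective on L.\<close>
  define f where "f = (\<lambda>x\<in>carrier M. inv_into L ?p (k x))"
  have f: "f x \<in> L" "?p (f x) = k x" if "x \<in> carrier M" for x
    using hom_mem[OF k(1) that] that unfolding image_module_carrier[OF qB]
    by (simp_all add: f_def inv_into_into f_inv_into_f)
  have p_inj: "x = y" if "?p x = ?p y" "x \<in> L" "y \<in> L" for x y
    using that quotient_map_eq_iff[OF qB] diff_eq_zero_iff sub_mem[OF L] by blast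
  have "f \<in> E"
  proof (rule lmod_homI)
    fix x y assume xy: "x \<in> carrier M" "y \<in> carrier M"
    then have "?p (f (x \<oplus>\<^bsub>M\<^esub> y)) = ?p (f x \<oplus>\<^bsub>M\<^esub> f y)"
      using hom_add[OF k(1) xy] image_module_add[OF qB, of "f x" "f y"] f by simp
    then show "f (x \<oplus>\<^bsub>M\<^esub> y) = f x \<oplus>\<^bsub>M\<^esub> f y"
      using xy f(1) sub_add[OF L] by (intro p_inj) auto
  next
    fix a x assume ax: "a \<in> carrier R" "x \<in> carrier M"
    then have "?p (f (a \<odot>\<^bsub>M\<^esub> x)) = ?p (a \<odot>\<^bsub>M\<^esub> f x)"
      using hom_smult[OF k(1) ax] image_module_smult[OF qB, of a "f x"] f by simp
    then show "f (a \<odot>\<^bsub>M\<^esub> x) = a \<odot>\<^bsub>M\<^esub> f x"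
      using ax f(1) sub_smult[OF L] by (intro p_inj) auto
  qed (use f(1) sub_mem[OF L] in \<open>auto simp: f_def\<close>)
  moreover have "?q (f x) = h x" if "x \<in> carrier M" for x
    using that f[OF that] g(2)[of "f x"] fun_cong[OF k(2), of x] by (simp add: compose_def)
  ultimately show ?thesis using that f(1) by blast
qed

text \<open>The image f(A) is A modulo the part of A killed by f, so g can be read as a map into
  that quotient and lifted to A.\<close>

lemma projective_lift_along:
  assumes proj: "projective_in_sigma R M" and A: "sub A" and f: "f \<in> E"
    and g: "g \<in> E" "g ` carrier M \<subseteq> f ` A"
  obtains h where "h \<in> E" "h ` carrier M \<subseteq> A" "\<And>x. x \<in> carrier M \<Longrightarrow> f (h x) = g x"
proof -
  define T where "T = A \<inter> a_kernel M M f"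
  have T: "sub T" unfolding T_def using A sub_kernel[OF f] by (rule sub_Int)
  let ?q = "sigma_code M T"
  note q = quotient_map_sigma_code[OF A T]
  have q_eq: "?q x = ?q y \<longleftrightarrow> f x = f y" if "x \<in> A" "y \<in> A" for x y
    using that sub_mem[OF A] sub_diff[OF A] unfolding quotient_map_eq_iff[OF q that]
    by (simp add: T_def mem_kernel_iff E_diff[OF f] diff_eq_zero_iff E_mem[OF f])
  \<comment> \<open>An arbitrary choice of preimages in A. It need not be linear, but it becomes
    linear modulo T.\<close>
  define r where "r x = inv_into A f (g x)" for x
  have r: "r x \<in> A" "f (r x) = g x" if "x \<in> carrier M" for x
    using g(2) that by (auto simp: r_def inv_into_into f_inv_into_f image_subset_iff)
  note m = sub_mem[OF A]
  have "(\<lambda>x\<in>carrier M. ?q (r x)) \<in> lmod_hom R M (image_module M A ?q)"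
  proof (rule lmod_homI)
    fix x y assume "x \<in> carrier M" "y \<in> carrier M"
    then show "(\<lambda>x\<in>carrier M. ?q (r x)) (x \<oplus>\<^bsub>M\<^esub> y) =
        (\<lambda>x\<in>carrier M. ?q (r x)) x \<oplus>\<^bsub>image_module M A ?q\<^esub> (\<lambda>x\<in>carrier M. ?q (r x)) y"
      using r m sub_add[OF A] by (simp add: image_module_add[OF q] q_eq E_add[OF f] E_add[OF g(1)])
  next
    fix a x assume "a \<in> carrier R" "x \<in> carrier M"
    then show "(\<lambda>x\<in>carrier M. ?q (r x)) (a \<odot>\<^bsub>M\<^esub> x) =
        a \<odot>\<^bsub>image_module M A ?q\<^esub> (\<lambda>x\<in>carrier M. ?q (r x)) x"
      using r m sub_smult[OF A]
      by (simp add: image_module_smult[OF q] q_eq E_smult[OF f] E_smult[OF g(1)])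
  qed (use r in \<open>auto simp: image_module_carrier[OF q]\<close>)
  then obtain h where h: "h \<in> E" "h ` carrier M \<subseteq> A"
      "\<And>x. x \<in> carrier M \<Longrightarrow> ?q (h x) = (\<lambda>x\<in>carrier M. ?q (r x)) x"
    using projective_lift[OF proj A T] T_def by blast
  moreover have "f (h x) = g x" if "x \<in> carrier M" for x
    using h(2) h(3)[OF that] r[OF that] q_eq[of "h x" "r x"] that by auto
  ultimately show ?thesis using that by blast
qed

end

section \<open>Submodules of a co-semisimple projective module\<close>

context left_module
begin

text \<open>
  In the language of the product \<open>N\<^sub>M K\<close> this says \<open>L = L\<^sub>M L\<close> for every submodule \<open>L\<close>.  A simple
  subquotient \<open>D/K\<close> of \<open>L\<close> that detects \<open>x \<in> L - T\<close> is \<open>M\<close>-injective, so \<open>D \<rightarrow> D/K\<close> extends to \<open>M\<close>,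
  and the extension lifts to an endomorphism with values in \<open>D\<close>.
\<close>

lemma co_semisimple_subset:
  assumes proj: "projective_in_sigma R M" and cos: "co_semisimple R M"
    and L: "sub L" and T: "sub T"
    and LT: "\<And>g. g \<in> E \<Longrightarrow> g ` carrier M \<subseteq> L \<Longrightarrow> g ` L \<subseteq> T"
  shows "L \<subseteq> T"
proof
  fix x assume x: "x \<in> L"
  show "x \<in> T"
  proof (rule ccontr)
    assume nx: "x \<notin> T"
    \<comment> \<open>For K maximal in this family, each submodule of L strictly above K contains x,
      hence Rx + K. This makes (Rx + K)/K simple.\<close>
    define \<A> where "\<A> = {K. sub K \<and> T \<inter> L \<subseteq> K \<and> K \<subseteq> L \<and> x \<notin> K}"
    have "\<exists>K\<in>\<A>. \<forall>X\<in>\<A>. K \<subseteq> X \<longrightarrow> X = K"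
    proof (rule subset_Zorn_nonempty)
      have "T \<inter> L \<in> \<A>" unfolding \<A>_def using nx sub_Int[OF T L] by simp
      then show "\<A> \<noteq> {}" by blast
      fix C assume C: "C \<noteq> {}" "subset.chain \<A> C"
      then have CA: "C \<subseteq> \<A>" and lin: "\<And>N K. N \<in> C \<Longrightarrow> K \<in> C \<Longrightarrow> N \<subseteq> K \<or> K \<subseteq> N"
        unfolding subset_chain_def by blast+
      have "sub (\<Union>C)"
        using CA by (intro sub_Union_chain[OF C(1) _ lin]) (auto simp: \<A>_def)
      moreover have "T \<inter> L \<subseteq> \<Union>C" "\<Union>C \<subseteq> L" "x \<notin> \<Union>C"
        using CA C(1) by (fastforce simp: \<A>_def)+
      ultimately show "\<Union>C \<in> \<A>" by (simp add: \<A>_def)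
    qed
    then obtain K where "K \<in> \<A>" and max: "\<And>X. X \<in> \<A> \<Longrightarrow> K \<subseteq> X \<Longrightarrow> X = K" by blast
    then have K: "sub K" "T \<inter> L \<subseteq> K" "K \<subseteq> L" "x \<notin> K" by (auto simp: \<A>_def)
    have xM: "x \<in> carrier M" using x sub_mem[OF L] by blast
    define Rx where "Rx = (\<lambda>a. a \<odot>\<^bsub>M\<^esub> x) ` carrier R"
    have Rx: "sub Rx" unfolding Rx_def by (rule sub_cyclic[OF xM])
    have x_Rx: "x \<in> Rx" unfolding Rx_def using xM by (intro image_eqI[of _ _ "\<one>\<^bsub>R\<^esub>"]) auto
    define D where "D = Rx <+>\<^bsub>M\<^esub> K"
    have D: "sub D" unfolding D_def by (rule sub_set_add[OF Rx K(1)])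
    have xD: "x \<in> D" and KD: "K \<subseteq> D"
      using set_add_upper1[OF Rx K(1)] set_add_upper2[OF Rx K(1)] x_Rx by (auto simp: D_def)
    have D_least: "D \<subseteq> P" if "sub P" "x \<in> P" "K \<subseteq> P" for P
      unfolding D_def using that sub_smult[OF that(1)]
      by (intro set_add_least) (auto simp: Rx_def)
    have DL: "D \<subseteq> L" using D_least[OF L x K(3)] .
    let ?q = "sigma_code M K" and ?S = "image_module M D (sigma_code M K)"
    note q = quotient_map_sigma_code[OF D K(1)]
    interpret S: left_module R ?S by (rule image_module_left_module[OF q])
    have qx: "?q x \<noteq> ?q \<zero>\<^bsub>M\<^esub>" using quotient_map_zero_iff[OF q xD] K(4) by blast
    have "simple_lmod R ?S"
      unfolding simple_lmod_def
    proof (intro conjI allI impI)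
      show "left_module R ?S" by (rule image_module_left_module[OF q])
      show "carrier ?S \<noteq> {\<zero>\<^bsub>?S\<^esub>}"
        using qx xD unfolding image_module_carrier[OF q] image_module_zero[OF q] by blast
      fix N assume N: "S.sub N"
      \<comment> \<open>The submodule N of D/K is pulled back to P, which lies between K and D.
        Whether x belongs to P decides between P = D and P = K.\<close>
      define P where "P = {y \<in> D. ?q y \<in> N}"
      have P: "sub P"
      proof (rule subI)
        show "P \<subseteq> carrier M" using sub_carrier[OF D] by (auto simp: P_def)
        show "\<zero>\<^bsub>M\<^esub> \<in> P"
          using S.sub_zero[OF N] sub_zero[OF D] by (simp add: P_def image_module_zero[OF q])
        show "\<And>x y. x \<in> P \<Longrightarrow> y \<in> P \<Longrightarrow> x \<oplus>\<^bsub>M\<^esub> y \<in> P"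
          using S.sub_add[OF N] sub_add[OF D] by (auto simp: P_def simp flip: image_module_add[OF q])
        show "\<And>a x. a \<in> carrier R \<Longrightarrow> x \<in> P \<Longrightarrow> a \<odot>\<^bsub>M\<^esub> x \<in> P"
          using S.sub_smult[OF N] sub_smult[OF D]
          by (auto simp: P_def simp flip: image_module_smult[OF q])
      qed
      have KP: "K \<subseteq> P"
      proof
        fix y assume "y \<in> K"
        then have "y \<in> D" "?q y = ?q \<zero>\<^bsub>M\<^esub>" using KD quotient_map_zero_iff[OF q] by blast+
        then show "y \<in> P" using S.sub_zero[OF N] by (simp add: P_def image_module_zero[OF q])
      qed
      have N_sub: "N \<subseteq> ?q ` P"
        using S.sub_carrier[OF N] unfolding image_module_carrier[OF q] P_def by blast
      show "N = {\<zero>\<^bsub>?S\<^esub>} \<or> N = carrier ?S"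
      proof (cases "x \<in> P")
        case True
        then have "P = D" using D_least[OF P _ KP] by (auto simp: P_def)
        then have "?q ` D \<subseteq> N" by (auto simp: P_def)
        then show ?thesis
          using S.sub_carrier[OF N] unfolding image_module_carrier[OF q] by blast
      next
        case False
        then have "P = K" using P KP K(2) DL by (intro max) (auto simp: \<A>_def P_def)
        then have "?q y = ?q \<zero>\<^bsub>M\<^esub>" if "y \<in> P" for y
          using that KD quotient_map_zero_iff[OF q, of y] by blast
        then have "N \<subseteq> {\<zero>\<^bsub>?S\<^esub>}" using N_sub unfolding image_module_zero[OF q] by blast
        then show ?thesis using S.sub_zero[OF N] by blast
      qed
    qed
    then have inj: "M_injective R M ?S"
      using cos image_module_in_sigma[OF q] unfolding co_semisimple_def by blast
    have "(\<lambda>y\<in>D. ?q y) \<in> lmod_hom R (M\<lparr>carrier := D\<rparr>) ?S"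
      by (rule lmod_homI)
        (use sub_add[OF D] sub_smult[OF D] in \<open>auto simp: image_module_simps[OF q]\<close>)
    then obtain h where h: "h \<in> lmod_hom R M ?S" "\<And>y. y \<in> D \<Longrightarrow> h y = ?q y"
      using inj D unfolding M_injective_def by (metis (no_types, lifting) restrict_apply')
    obtain f where f: "f \<in> E" "f ` carrier M \<subseteq> D" "\<And>y. y \<in> carrier M \<Longrightarrow> ?q (f y) = h y"
      using projective_lift[OF proj D K(1) KD h(1)] by blast
    \<comment> \<open>The contradiction: f(x) is congruent to x modulo K, hence outside K, while
      f(L) \<subseteq> T puts f(x) into T \<inter> L, which is inside K.\<close>
    have "f ` L \<subseteq> T" using LT[OF f(1)] f(2) DL by blast
    then have "f x \<in> T" using x by blast
    moreover have fD: "f x \<in> D" using f(2) xM by blast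
    ultimately have "f x \<in> K" using DL K(2) by blast
    then have "?q (f x) = ?q \<zero>\<^bsub>M\<^esub>" using quotient_map_zero_iff[OF q fD] by blast
    then show False using f(3)[OF xM] h(2)[OF xD] qx by simp
  qed
qed

text \<open>Semiprimeness of M: with T = 0 in \<open>co_semisimple_subset\<close>, a nonzero L
  cannot have \<open>L\<^sub>M L = 0\<close>.\<close>

lemma co_semisimple_nonzero_endo:
  assumes "projective_in_sigma R M" "co_semisimple R M" "sub L" "L \<noteq> {\<zero>\<^bsub>M\<^esub>}"
  obtains g x where "g \<in> E" "g ` carrier M \<subseteq> L" "x \<in> L" "g x \<noteq> \<zero>\<^bsub>M\<^esub>"
proof -
  have "\<not> L \<subseteq> {\<zero>\<^bsub>M\<^esub>}" using assms(4) sub_zero[OF assms(3)] by blast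
  then obtain g where "g \<in> E" "g ` carrier M \<subseteq> L" "\<not> g ` L \<subseteq> {\<zero>\<^bsub>M\<^esub>}"
    using co_semisimple_subset[OF assms(1-3) sub_trivial] by blast
  then show ?thesis using that by blast
qed

end

section \<open>Finite uniform dimension\<close>

text \<open>Existence of such a function \<open>d\<close> is equivalent to finite uniform dimension; it passes to
  submodules and supports induction along strictly increasing direct sums.\<close>

definition rank_function :: "'a ring \<Rightarrow> ('a, 'b) module \<Rightarrow> ('b set \<Rightarrow> nat) \<Rightarrow> bool" where
  "rank_function R M d \<longleftrightarrow> (\<forall>V W. submodule V R M \<and> submodule W R M \<and> V \<noteq> {\<zero>\<^bsub>M\<^esub>} \<and>
     V \<inter> W = {\<zero>\<^bsub>M\<^esub>} \<longrightarrow> d (V <+>\<^bsub>M\<^esub> W) < d W)"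

context left_module
begin

lemma rank_functionD:
  "rank_function R M d \<Longrightarrow> sub V \<Longrightarrow> sub W \<Longrightarrow> V \<noteq> {\<zero>\<^bsub>M\<^esub>} \<Longrightarrow> V \<inter> W = {\<zero>\<^bsub>M\<^esub>} \<Longrightarrow>
    d (V <+>\<^bsub>M\<^esub> W) < d W"
  by (simp add: rank_function_def)

lemma mem_set_addI:
  assumes "sub A" "sub B" "u \<in> carrier M" "s \<in> B" "u \<oplus>\<^bsub>M\<^esub> s \<in> A" shows "u \<in> A <+>\<^bsub>M\<^esub> B"
proof -
  have "u = (u \<oplus>\<^bsub>M\<^esub> s) \<oplus>\<^bsub>M\<^esub> (\<ominus>\<^bsub>M\<^esub> s)"
    using assms sub_mem[OF assms(2)] by (simp add: M.a_assoc M.r_neg)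
  then show ?thesis using set_addI assms(5) sub_minus[OF assms(2,4)] by metis
qed

lemma mem_set_addI':
  assumes "sub A" "sub B" "u \<in> carrier M" "s \<in> A" "s \<oplus>\<^bsub>M\<^esub> u \<in> B" shows "u \<in> A <+>\<^bsub>M\<^esub> B"
proof -
  have "u = (\<ominus>\<^bsub>M\<^esub> s) \<oplus>\<^bsub>M\<^esub> (s \<oplus>\<^bsub>M\<^esub> u)"
    using assms sub_mem[OF assms(1)] by (simp add: M.a_assoc[symmetric] M.l_neg)
  then show ?thesis using set_addI assms(5) sub_minus[OF assms(1,4)] by metis
qed

text \<open>Each W \<inter> U i is essential in the uniform module U i, and a direct sum of
  essential submodules is essential in the direct sum. The induction adds one summand U i to the sum
  S of the earlier ones.\<close>

lemma meets_uniform_sum: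
  assumes U: "\<And>i. i \<in> I \<Longrightarrow> uniform_submodule R M (U i)"
    and ind: "independent_family R M I U" and W: "sub W"
    and meets: "\<And>i. i \<in> I \<Longrightarrow> W \<inter> U i \<noteq> {\<zero>\<^bsub>M\<^esub>}"
    and "finite J" "J \<subseteq> I" "sub A" "A \<noteq> {\<zero>\<^bsub>M\<^esub>}" "A \<subseteq> submodule_sum R M (U ` J)"
  shows "A \<inter> W \<noteq> {\<zero>\<^bsub>M\<^esub>}"
  using assms(5-)
proof (induction J arbitrary: A)
  case empty
  then show ?case using sub_zero[of A] by (auto simp: submodule_sum_empty)
next
  case (insert i J)
  let ?S = "submodule_sum R M (U ` J)"
  note A = \<open>sub A\<close>
  have subU: "sub (U j)" if "j \<in> insert i J" for j
    using U that insert.prems(1) by (auto simp: uniform_submodule_def)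
  have Ui: "sub (U i)" using subU by simp
  have S: "sub ?S" using subU by (intro sub_submodule_sum) auto
  have "?S \<subseteq> submodule_sum R M (U ` (I - {i}))"
    using insert.hyps insert.prems(1) by (intro submodule_sum_mono) auto
  moreover have "U i \<inter> submodule_sum R M (U ` (I - {i})) = {\<zero>\<^bsub>M\<^esub>}"
    using ind insert.prems(1) by (auto simp: independent_family_def)
  ultimately have US: "x = \<zero>\<^bsub>M\<^esub>" if "x \<in> U i" "x \<in> ?S" for x
    using that by blast
  have A_sub: "A \<subseteq> U i <+>\<^bsub>M\<^esub> ?S"
    using insert.prems(4) submodule_sum_insert[of "U i" "U ` J"] subU by auto
  note IH = insert.IH[OF subset_trans[OF subset_insertI insert.prems(1)]]
  note mA = sub_mem[OF A] and mS = sub_mem[OF S] and mU = sub_mem[OF Ui] and mW = sub_mem[OF W]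
  show ?case
  proof
    assume AW: "A \<inter> W = {\<zero>\<^bsub>M\<^esub>}"
    have AS: "A \<inter> ?S = {\<zero>\<^bsub>M\<^esub>}"
    proof (rule ccontr)
      assume "A \<inter> ?S \<noteq> {\<zero>\<^bsub>M\<^esub>}"
      then have "A \<inter> ?S \<inter> W \<noteq> {\<zero>\<^bsub>M\<^esub>}" by (intro IH sub_Int A S) auto
      then show False using AW sub_zero[OF S] by blast
    qed
    \<comment> \<open>The projection of A to U i along S. It is nonzero because A meets S trivially,
      so uniformity of U i produces a nonzero w in A' that also lies in W.\<close>
    define A' where "A' = U i \<inter> (A <+>\<^bsub>M\<^esub> ?S)"
    have A': "sub A'" unfolding A'_def by (intro sub_Int Ui sub_set_add A S)
    obtain a where a: "a \<in> A" "a \<noteq> \<zero>\<^bsub>M\<^esub>" using sub_nontrivialE[OF A insert.prems(3)] .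
    obtain u s where us: "u \<in> U i" "s \<in> ?S" "a = u \<oplus>\<^bsub>M\<^esub> s"
      using A_sub a(1) by (auto elim!: set_addE)
    have "u \<in> A'" using mem_set_addI[OF A S, of u s] us a mU by (simp add: A'_def)
    moreover have "u \<noteq> \<zero>\<^bsub>M\<^esub>" using us a AS mS by auto
    ultimately have "A' \<noteq> {\<zero>\<^bsub>M\<^esub>}" by blast
    moreover have "W \<inter> U i \<noteq> {\<zero>\<^bsub>M\<^esub>}" using meets insert.prems(1) by simp
    ultimately have "A' \<inter> (W \<inter> U i) \<noteq> {\<zero>\<^bsub>M\<^esub>}"
      using U[of i] insert.prems(1) A' sub_Int[OF W Ui] unfolding uniform_submodule_def
      by (auto simp: A'_def)
    then obtain w where w: "w \<in> A'" "w \<in> W" "w \<in> U i" "w \<noteq> \<zero>\<^bsub>M\<^esub>"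
      using sub_nontrivialE[OF sub_Int[OF A' sub_Int[OF W Ui]]] by blast
    then obtain b t where bt: "b \<in> A" "t \<in> ?S" "w = b \<oplus>\<^bsub>M\<^esub> t"
      by (auto simp: A'_def elim!: set_addE)
    \<comment> \<open>Writing w = b + t with b in A and t in S, the component t lies in B and is
      nonzero, since otherwise w would be in A \<inter> W. As B is inside S, the induction
      hypothesis applies to B.\<close>
    define B where "B = ?S \<inter> (A <+>\<^bsub>M\<^esub> (W \<inter> U i))"
    have B: "sub B" unfolding B_def by (intro sub_Int Ui sub_set_add A S W)
    have "t \<in> B"
      using mem_set_addI'[OF A sub_Int[OF W Ui], of t b] bt w mS by (simp add: B_def)
    moreover have "t \<noteq> \<zero>\<^bsub>M\<^esub>" using bt w AW mA by auto
    ultimately have "B \<noteq> {\<zero>\<^bsub>M\<^esub>}" by blast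
    then have "B \<inter> W \<noteq> {\<zero>\<^bsub>M\<^esub>}" by (intro IH B) (auto simp: B_def)
    then obtain c where c: "c \<in> B" "c \<in> W" "c \<noteq> \<zero>\<^bsub>M\<^esub>"
      using sub_nontrivialE[OF sub_Int[OF B W]] by blast
    then obtain a' w' where aw: "a' \<in> A" "w' \<in> W" "w' \<in> U i" "c = a' \<oplus>\<^bsub>M\<^esub> w'"
      by (auto simp: B_def elim!: set_addE)
    then have "a' \<in> W" using sub_add_cancel_right[OF W aw(2), of a'] mA c(2) by blast
    then have "a' = \<zero>\<^bsub>M\<^esub>" using AW aw by blast
    then have "c = w'" using aw mU by simp
    then show False using US[of c] c aw by (auto simp: B_def)
  qed
qed

text \<open>Take for d W the largest number of the given U i whose sum meets W trivially. If J is
  optimal for V + W, then V meets S J + W trivially, so S J + W is not essential and by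
  \<open>meets_uniform_sum\<close> misses some U i. Adding i to J gives a larger set that is
  admissible for W.\<close>

lemma uniform_dimension_imp_rank:
  assumes "has_uniform_dimension R M n"
  obtains d where "rank_function R M d"
proof -
  obtain U :: "nat \<Rightarrow> 'b set" where U: "\<And>i. i < n \<Longrightarrow> uniform_submodule R M (U i)"
    and ind: "independent_family R M {..<n} U"
    and ess: "essential_in R M (submodule_sum R M (U ` {..<n}))"
    using assms unfolding has_uniform_dimension_def by blast
  define S where "S J = submodule_sum R M (U ` J)" for J
  have subU: "sub (U i)" if "i < n" for i using U[OF that] by (simp add: uniform_submodule_def)
  have S: "sub (S J)" if "J \<subseteq> {..<n}" for J
    unfolding S_def using that subU by (intro sub_submodule_sum) auto
  have S_insert: "S (insert i J) = U i <+>\<^bsub>M\<^esub> S J" if "insert i J \<subseteq> {..<n}" for i J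
    unfolding S_def image_insert using that subU by (intro submodule_sum_insert) auto
  have ess_W: "A \<inter> W \<noteq> {\<zero>\<^bsub>M\<^esub>}"
    if W: "sub W" "\<And>i. i < n \<Longrightarrow> W \<inter> U i \<noteq> {\<zero>\<^bsub>M\<^esub>}" and A: "sub A" "A \<noteq> {\<zero>\<^bsub>M\<^esub>}" for A W
  proof -
    have "S {..<n} \<inter> A \<noteq> {\<zero>\<^bsub>M\<^esub>}"
      using ess A unfolding essential_in_def S_def by blast
    then have "(S {..<n} \<inter> A) \<inter> W \<noteq> {\<zero>\<^bsub>M\<^esub>}"
      using S[of "{..<n}"] A(1) W U
      by (intro meets_uniform_sum[OF _ ind, of W "{..<n}"]) (auto simp: S_def sub_Int)
    then show ?thesis using sub_zero[OF S[of "{..<n}"]] by blast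
  qed
  define \<J> where "\<J> W = {J. J \<subseteq> {..<n} \<and> S J \<inter> W = {\<zero>\<^bsub>M\<^esub>}}" for W
  have fin: "finite (card ` \<J> W)" for W by (simp add: \<J>_def)
  define d where "d W = Max (card ` \<J> W)" for W
  have "d (V <+>\<^bsub>M\<^esub> W) < d W"
    if V: "sub V" "V \<noteq> {\<zero>\<^bsub>M\<^esub>}" and W: "sub W" and VW: "V \<inter> W = {\<zero>\<^bsub>M\<^esub>}" for V W
  proof -
    note mV = sub_mem[OF V(1)] and mW = sub_mem[OF W]
    have sVW: "sub (V <+>\<^bsub>M\<^esub> W)" using V(1) W by (rule sub_set_add)
    \<comment> \<open>The empty index set is always admissible, so \<open>Max\<close> is taken over
      a nonempty finite set.\<close>
    have "{} \<in> \<J> (V <+>\<^bsub>M\<^esub> W)"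
      using sub_zero[OF sVW] by (auto simp: \<J>_def S_def submodule_sum_empty)
    then have "d (V <+>\<^bsub>M\<^esub> W) \<in> card ` \<J> (V <+>\<^bsub>M\<^esub> W)"
      unfolding d_def by (intro Max_in fin) blast
    then obtain J where J: "J \<subseteq> {..<n}" "S J \<inter> (V <+>\<^bsub>M\<^esub> W) = {\<zero>\<^bsub>M\<^esub>}"
      and dJ: "d (V <+>\<^bsub>M\<^esub> W) = card J"
      by (auto simp: \<J>_def)
    note sJ = S[OF J(1)] and mJ = sub_mem[OF S[OF J(1)]]
    define X where "X = S J <+>\<^bsub>M\<^esub> W"
    have X: "sub X" unfolding X_def using sJ W by (rule sub_set_add)
    have "V \<inter> X = {\<zero>\<^bsub>M\<^esub>}"
    proof (rule sub_eq_trivialI)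
      show "sub (V \<inter> X)" using V(1) X by (rule sub_Int)
      fix v assume v: "v \<in> V \<inter> X"
      then obtain s w where sw: "s \<in> S J" "w \<in> W" "v = s \<oplus>\<^bsub>M\<^esub> w"
        by (auto simp: X_def elim!: set_addE)
      then have "s \<in> V <+>\<^bsub>M\<^esub> W" using mem_set_addI[OF V(1) W, of s w] v mJ by simp
      then have "s = \<zero>\<^bsub>M\<^esub>" using Int_trivialD[OF J(2)] sw by blast
      then show "v = \<zero>\<^bsub>M\<^esub>" using Int_trivialD[OF VW, of v] sw v mW by simp
    qed
    then obtain i where i: "i < n" "X \<inter> U i = {\<zero>\<^bsub>M\<^esub>}"
      using ess_W[OF X _ V] by blast
    have "i \<notin> J"
    proof
      assume "i \<in> J"
      then have "U i \<subseteq> X"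
        using set_add_upper1[OF sJ W] submodule_sum_upper[of "U i" "U ` J"]
        by (auto simp: X_def S_def)
      then show False using i U[OF i(1)] by (auto simp: uniform_submodule_def)
    qed
    have iJ: "insert i J \<subseteq> {..<n}" using i J by auto
    have "S (insert i J) \<inter> W = {\<zero>\<^bsub>M\<^esub>}"
    proof (rule sub_eq_trivialI)
      show "sub (S (insert i J) \<inter> W)" using S[OF iJ] W by (rule sub_Int)
      fix w assume w: "w \<in> S (insert i J) \<inter> W"
      then obtain u s where us: "u \<in> U i" "s \<in> S J" "w = u \<oplus>\<^bsub>M\<^esub> s"
        by (auto simp: S_insert[OF iJ] elim!: set_addE)
      then have "s \<oplus>\<^bsub>M\<^esub> u \<in> W" using w mJ sub_mem[OF subU[OF i(1)]] by (simp add: M.a_comm)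
      then have "u \<in> X"
        using mem_set_addI'[OF sJ W, of u s] us sub_mem[OF subU[OF i(1)]] by (simp add: X_def)
      then have "u = \<zero>\<^bsub>M\<^esub>" using Int_trivialD[OF i(2)] us by blast
      then have "w = s" using us mJ by simp
      then show "w = \<zero>\<^bsub>M\<^esub>"
        using Int_trivialD[OF J(2), of w] us w set_add_upper2[OF V(1) W] by blast
    qed
    then have "card (insert i J) \<le> d W"
      unfolding d_def using iJ by (intro Max_ge fin imageI) (auto simp: \<J>_def)
    then show ?thesis using \<open>i \<notin> J\<close> finite_subset[OF J(1)] dJ by simp
  qed
  then have "rank_function R M d" by (simp add: rank_function_def)
  then show ?thesis using that by blast
qed

text \<open>W collects discarded summands. If A is not uniform it contains a direct sum of nonzero B
  and C; moving B into W lowers d, and the search goes on in C, which meets B + W trivially.\<close>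

lemma rank_imp_uniform_submodule:
  assumes d: "rank_function R M d"
    and "sub W" "sub A" "A \<noteq> {\<zero>\<^bsub>M\<^esub>}" "A \<inter> W = {\<zero>\<^bsub>M\<^esub>}"
  shows "\<exists>U\<subseteq>A. uniform_submodule R M U"
  using assms(2-)
proof (induction "d W" arbitrary: W A rule: less_induct)
  case less
  note W = less.prems(1) and A = less.prems(2) and A_nz = less.prems(3) and AW = less.prems(4)
  show ?case
  proof (cases "uniform_submodule R M A")
    case False
    then obtain B C where B: "sub B" "B \<subseteq> A" "B \<noteq> {\<zero>\<^bsub>M\<^esub>}" and C: "sub C" "C \<subseteq> A" "C \<noteq> {\<zero>\<^bsub>M\<^esub>}"
      and BC: "B \<inter> C = {\<zero>\<^bsub>M\<^esub>}"
      using A A_nz unfolding uniform_submodule_def by blast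
    have "B \<inter> W = {\<zero>\<^bsub>M\<^esub>}" using B AW sub_zero[OF B(1)] sub_zero[OF W] by blast
    then have "d (B <+>\<^bsub>M\<^esub> W) < d W" by (intro rank_functionD[OF d] B W)
    moreover have BW: "sub (B <+>\<^bsub>M\<^esub> W)" using B(1) W by (rule sub_set_add)
    moreover have "C \<inter> (B <+>\<^bsub>M\<^esub> W) = {\<zero>\<^bsub>M\<^esub>}"
    proof (rule sub_eq_trivialI)
      show "sub (C \<inter> (B <+>\<^bsub>M\<^esub> W))" using C(1) BW by (rule sub_Int)
      fix c assume c: "c \<in> C \<inter> (B <+>\<^bsub>M\<^esub> W)"
      then obtain b w where bw: "b \<in> B" "w \<in> W" "c = b \<oplus>\<^bsub>M\<^esub> w" by (auto elim!: set_addE)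
      then have "w \<in> A"
        using sub_add_cancel_left[OF A, of b w] B(2) C(2) c sub_mem[OF W] by blast
      then have "w = \<zero>\<^bsub>M\<^esub>" using Int_trivialD[OF AW] bw by blast
      then have "c = b" using bw sub_mem[OF B(1)] by simp
      then show "c = \<zero>\<^bsub>M\<^esub>" using Int_trivialD[OF BC] bw c by blast
    qed
    ultimately obtain U where "U \<subseteq> C" "uniform_submodule R M U"
      using less.hyps[of "B <+>\<^bsub>M\<^esub> W" C] C by blast
    then show ?thesis using C(2) by blast
  qed blast
qed

lemma independent_family_extend:
  assumes ind: "independent_family R M {..<n} U" and U: "\<And>i. i < n \<Longrightarrow> sub (U i)"
    and V: "sub V" "V \<inter> submodule_sum R M (U ` {..<n}) = {\<zero>\<^bsub>M\<^esub>}"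
  shows "independent_family R M {..<Suc n} (U(n := V))"
  unfolding independent_family_def
proof
  fix i assume "i \<in> {..<Suc n}"
  then consider "i = n" | "i < n" by force
  then show "(U(n := V)) i \<inter> submodule_sum R M ((U(n := V)) ` ({..<Suc n} - {i})) = {\<zero>\<^bsub>M\<^esub>}"
  proof cases
    case 1
    then have "(U(n := V)) ` ({..<Suc n} - {i}) = U ` {..<n}" by (auto simp: lessThan_Suc)
    then show ?thesis using 1 V by simp
  next
    case 2
    let ?S = "submodule_sum R M (U ` ({..<n} - {i}))"
    have S: "sub ?S" using U by (intro sub_submodule_sum) auto
    have sS: "sub (submodule_sum R M (U ` {..<n}))" using U by (intro sub_submodule_sum) auto
    have Ui: "sub (U i)" using U 2 by blast
    have "(U(n := V)) ` ({..<Suc n} - {i}) = insert V (U ` ({..<n} - {i}))"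
      using 2 by (auto simp: lessThan_Suc)
    then have eq: "submodule_sum R M ((U(n := V)) ` ({..<Suc n} - {i})) = V <+>\<^bsub>M\<^esub> ?S"
      using U by (simp only:) (rule submodule_sum_insert[OF V(1)], blast)
    have "U i \<inter> (V <+>\<^bsub>M\<^esub> ?S) = {\<zero>\<^bsub>M\<^esub>}"
    proof (rule sub_eq_trivialI)
      show "sub (U i \<inter> (V <+>\<^bsub>M\<^esub> ?S))" by (intro sub_Int sub_set_add Ui V(1) S)
      fix u assume u: "u \<in> U i \<inter> (V <+>\<^bsub>M\<^esub> ?S)"
      then obtain v s where vs: "v \<in> V" "s \<in> ?S" "u = v \<oplus>\<^bsub>M\<^esub> s" by (auto elim!: set_addE)
      have "?S \<subseteq> submodule_sum R M (U ` {..<n})" by (intro submodule_sum_mono) auto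
      moreover have "U i \<subseteq> submodule_sum R M (U ` {..<n})"
        using 2 by (intro submodule_sum_upper) auto
      \<comment> \<open>Here v = u - s is a difference of two elements of the old sum, which V meets
        only in 0.\<close>
      ultimately have "v \<in> submodule_sum R M (U ` {..<n})"
        using vs u sub_add_cancel_right[OF sS, of s v] sub_mem[OF V(1)] by blast
      then have "v = \<zero>\<^bsub>M\<^esub>" using Int_trivialD[OF V(2)] vs by blast
      then have "u = s" using vs sub_mem[OF S] by simp
      moreover have "U i \<inter> ?S = {\<zero>\<^bsub>M\<^esub>}" using ind 2 by (simp add: independent_family_def)
      ultimately show "u = \<zero>\<^bsub>M\<^esub>" using Int_trivialD[of "U i" ?S u] vs u by blast
    qed
    then show ?thesis using 2 eq by simp
  qed
qed

text \<open>Greedy construction from the empty family: as long as the direct sum is not essential, a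
  uniform submodule that meets it trivially is adjoined. Each step lowers d of the sum, so the
  process ends.\<close>

lemma rank_imp_uniform_dimension:
  assumes d: "rank_function R M d"
  shows "\<exists>n. has_uniform_dimension R M n"
proof -
  have "\<exists>n. has_uniform_dimension R M n"
    if "\<And>i. i < k \<Longrightarrow> uniform_submodule R M (U i)" "independent_family R M {..<k} U"
    for k :: nat and U :: "nat \<Rightarrow> 'b set"
    using that
  proof (induction "d (submodule_sum R M (U ` {..<k}))" arbitrary: k U rule: less_induct)
    case less
    let ?S = "submodule_sum R M (U ` {..<k})"
    have subU: "sub (U i)" if "i < k" for i
      using less.prems(1)[OF that] by (simp add: uniform_submodule_def)
    have S: "sub ?S" using subU by (intro sub_submodule_sum) auto
    show ?case
    proof (cases "essential_in R M ?S")
      case True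
      then show ?thesis using less.prems unfolding has_uniform_dimension_def by blast
    next
      case False
      then obtain A where A: "sub A" "A \<noteq> {\<zero>\<^bsub>M\<^esub>}" "A \<inter> ?S = {\<zero>\<^bsub>M\<^esub>}"
        using S unfolding essential_in_def by blast
      then obtain V where V: "V \<subseteq> A" "uniform_submodule R M V"
        using rank_imp_uniform_submodule[OF d S] by blast
      then have sV: "sub V" "V \<noteq> {\<zero>\<^bsub>M\<^esub>}" by (auto simp: uniform_submodule_def)
      have VS: "V \<inter> ?S = {\<zero>\<^bsub>M\<^esub>}" using V(1) A(3) sub_zero[OF sV(1)] sub_zero[OF S] by blast
      let ?U = "U(k := V)"
      have "?U ` {..<Suc k} = insert V (U ` {..<k})" by (auto simp: lessThan_Suc)
      then have "submodule_sum R M (?U ` {..<Suc k}) = V <+>\<^bsub>M\<^esub> ?S"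
        using subU by (simp only:) (rule submodule_sum_insert[OF sV(1)], blast)
      then have "d (submodule_sum R M (?U ` {..<Suc k})) < d ?S"
        using rank_functionD[OF d sV(1) S sV(2) VS] by simp
      moreover have "independent_family R M {..<Suc k} ?U"
        using independent_family_extend[OF less.prems(2) subU sV(1) VS] .
      moreover have "uniform_submodule R M (?U i)" if "i < Suc k" for i
        using that less.prems(1)[of i] V(2) by (auto simp: less_Suc_eq)
      ultimately show ?thesis using less.hyps[of ?U "Suc k"] by blast
    qed
  qed
  from this[of 0] show ?thesis by (simp add: independent_family_def)
qed

text \<open>Submodules of N are submodules of M inside N, with the same sums and intersections, so d
  itself serves for N. No family of uniform submodules of N has to be exhibited.\<close>

lemma rank_function_submodule:
  assumes "rank_function R M d" "sub N" shows "rank_function R (M\<lparr>carrier := N\<rparr>) d"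
proof -
  have "A <+>\<^bsub>M\<lparr>carrier := N\<rparr>\<^esub> B = A <+>\<^bsub>M\<^esub> B" for A B
    by (simp add: set_add_def')
  then show ?thesis
    using assms(1) by (simp add: rank_function_def submodule_submodule_iff[OF assms(2)])
qed

end

section \<open>Fully invariant submodules\<close>

context left_module
begin

lemma fully_invariantD:
  assumes "fully_invariant R M N"
  shows "sub N" "f \<in> E \<Longrightarrow> x \<in> N \<Longrightarrow> f x \<in> N"
  using assms by (auto simp: fully_invariant_def)

lemma fully_invariant_Int:
  "fully_invariant R M N \<Longrightarrow> fully_invariant R M K \<Longrightarrow> fully_invariant R M (N \<inter> K)"
  unfolding fully_invariant_def by (meson Int_greatest Int_lower1 Int_lower2 image_mono order_trans sub_Int)

lemma fully_invariant_set_add: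
  assumes N: "fully_invariant R M N" and K: "fully_invariant R M K"
  shows "fully_invariant R M (N <+>\<^bsub>M\<^esub> K)"
  unfolding fully_invariant_def
proof (intro conjI ballI subsetI)
  note sN = fully_invariantD(1)[OF N] and sK = fully_invariantD(1)[OF K]
  show "sub (N <+>\<^bsub>M\<^esub> K)" using sN sK by (rule sub_set_add)
  fix f y assume f: "f \<in> E" and "y \<in> f ` (N <+>\<^bsub>M\<^esub> K)"
  then obtain n k where "n \<in> N" "k \<in> K" "y = f (n \<oplus>\<^bsub>M\<^esub> k)" by (auto elim!: set_addE)
  then show "y \<in> N <+>\<^bsub>M\<^esub> K"
    using fully_invariantD(2)[OF N f] fully_invariantD(2)[OF K f] sub_mem[OF sN] sub_mem[OF sK]
    by (simp add: E_add[OF f] set_addI)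
qed

lemma fully_invariant_trivial: "fully_invariant R M {\<zero>\<^bsub>M\<^esub>}"
  by (auto simp: fully_invariant_def sub_trivial E_zero)

text \<open>\<open>hom_annihilator N\<close> is the largest \<open>A \<le> M\<close> with \<open>A\<^sub>M N = 0\<close>.\<close>

definition hom_annihilator :: "'b set \<Rightarrow> 'b set" where
  "hom_annihilator N = {x \<in> carrier M. \<forall>f\<in>E. f ` carrier M \<subseteq> N \<longrightarrow> f x = \<zero>\<^bsub>M\<^esub>}"

lemma hom_annihilatorD:
  "x \<in> hom_annihilator N \<Longrightarrow> f \<in> E \<Longrightarrow> f ` carrier M \<subseteq> N \<Longrightarrow> f x = \<zero>\<^bsub>M\<^esub>"
  by (simp add: hom_annihilator_def)

text \<open>Maps M -> N are stable under precomposition with endomorphisms: if g maps into N, so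
  does g after f, and hence g kills f(x) whenever x is annihilated.\<close>

lemma fully_invariant_hom_annihilator: "fully_invariant R M (hom_annihilator N)"
  unfolding fully_invariant_def
proof (intro conjI ballI subsetI)
  show "sub (hom_annihilator N)"
  proof (rule subI)
    have mem: "x \<in> carrier M" if "x \<in> hom_annihilator N" for x
      using that by (simp add: hom_annihilator_def)
    show "x \<oplus>\<^bsub>M\<^esub> y \<in> hom_annihilator N"
      if x: "x \<in> hom_annihilator N" and y: "y \<in> hom_annihilator N" for x y
    proof -
      have "f (x \<oplus>\<^bsub>M\<^esub> y) = \<zero>\<^bsub>M\<^esub>" if "f \<in> E" "f ` carrier M \<subseteq> N" for f
        using hom_annihilatorD[OF x that] hom_annihilatorD[OF y that] mem[OF x] mem[OF y]
        by (simp add: E_add[OF that(1)])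
      then show ?thesis using mem[OF x] mem[OF y] by (simp add: hom_annihilator_def)
    qed
    show "a \<odot>\<^bsub>M\<^esub> x \<in> hom_annihilator N" if a: "a \<in> carrier R" and x: "x \<in> hom_annihilator N" for a x
    proof -
      have "f (a \<odot>\<^bsub>M\<^esub> x) = \<zero>\<^bsub>M\<^esub>" if "f \<in> E" "f ` carrier M \<subseteq> N" for f
        using hom_annihilatorD[OF x that] a mem[OF x] by (simp add: E_smult[OF that(1)])
      then show ?thesis using a mem[OF x] by (simp add: hom_annihilator_def)
    qed
  qed (auto simp: hom_annihilator_def E_zero)
  fix f y assume f: "f \<in> E" and "y \<in> f ` hom_annihilator N"
  then obtain x where x: "x \<in> hom_annihilator N" "y = f x" by blast
  then have xM: "x \<in> carrier M" by (simp add: hom_annihilator_def)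
  have "g y = \<zero>\<^bsub>M\<^esub>" if g: "g \<in> E" "g ` carrier M \<subseteq> N" for g
  proof -
    have "compose (carrier M) g f ` carrier M \<subseteq> N"
      using g E_mem[OF f] by (auto simp: compose_def)
    then have "compose (carrier M) g f x = \<zero>\<^bsub>M\<^esub>"
      using hom_annihilatorD[OF x(1) E_compose[OF g(1) f]] by blast
    then show ?thesis using x xM by (simp add: compose_def)
  qed
  then show "y \<in> hom_annihilator N"
    using E_mem[OF f xM] x by (simp add: hom_annihilator_def)
qed

lemma projection_exists:
  assumes N: "sub N" and K: "sub K" and NK: "N \<inter> K = {\<zero>\<^bsub>M\<^esub>}" "N <+>\<^bsub>M\<^esub> K = carrier M"
  obtains p where "p \<in> E" "p ` carrier M \<subseteq> N" "\<And>x. x \<in> N \<Longrightarrow> p x = x" "\<And>x. x \<in> K \<Longrightarrow> p x = \<zero>\<^bsub>M\<^esub>"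
proof -
  note mN = sub_mem[OF N] and mK = sub_mem[OF K]
  define p where "p = (\<lambda>x\<in>carrier M. SOME n. n \<in> N \<and> x \<ominus>\<^bsub>M\<^esub> n \<in> K)"
  have p: "p x \<in> N" "x \<ominus>\<^bsub>M\<^esub> p x \<in> K" if x: "x \<in> carrier M" for x
  proof -
    obtain n k where "n \<in> N" "k \<in> K" "x = n \<oplus>\<^bsub>M\<^esub> k"
      using x unfolding NK(2)[symmetric] by (rule set_addE)
    then have "n \<in> N \<and> x \<ominus>\<^bsub>M\<^esub> n \<in> K" using eq_add_iff[of x n k] x mN mK by auto
    then have "(SOME n. n \<in> N \<and> x \<ominus>\<^bsub>M\<^esub> n \<in> K) \<in> N \<and> x \<ominus>\<^bsub>M\<^esub> (SOME n. n \<in> N \<and> x \<ominus>\<^bsub>M\<^esub> n \<in> K) \<in> K"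
      by (rule someI)
    then show "p x \<in> N" "x \<ominus>\<^bsub>M\<^esub> p x \<in> K" using that by (auto simp: p_def)
  qed
  \<comment> \<open>As the sum is direct, the component in N is unique; linearity of p then only
    requires exhibiting the expected component.\<close>
  have unique: "p x = n" if x: "x \<in> carrier M" and n: "n \<in> N" and k: "x \<ominus>\<^bsub>M\<^esub> n \<in> K" for x n
  proof -
    have "p x \<ominus>\<^bsub>M\<^esub> x \<in> K" using sub_diff_sym[OF K] p[OF x] mN x by blast
    then have "(p x \<ominus>\<^bsub>M\<^esub> x) \<oplus>\<^bsub>M\<^esub> (x \<ominus>\<^bsub>M\<^esub> n) \<in> K" using k by (rule sub_add[OF K])
    then have "p x \<ominus>\<^bsub>M\<^esub> n \<in> K" using diff_trans[of "p x" x n] p[OF x] n mN x by simp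
    moreover have "p x \<ominus>\<^bsub>M\<^esub> n \<in> N" using p[OF x] n by (intro sub_diff[OF N])
    ultimately have "p x \<ominus>\<^bsub>M\<^esub> n = \<zero>\<^bsub>M\<^esub>" using NK(1) by blast
    then show ?thesis using diff_eq_zero_iff p[OF x] n mN by blast
  qed
  have "p \<in> E"
  proof (rule lmod_homI)
    fix x y assume x: "x \<in> carrier M" and y: "y \<in> carrier M"
    have "(x \<ominus>\<^bsub>M\<^esub> p x) \<oplus>\<^bsub>M\<^esub> (y \<ominus>\<^bsub>M\<^esub> p y) = (x \<oplus>\<^bsub>M\<^esub> y) \<ominus>\<^bsub>M\<^esub> (p x \<oplus>\<^bsub>M\<^esub> p y)"
      using x y mN[OF p(1)[OF x]] mN[OF p(1)[OF y]]
      by (simp add: M.minus_eq M.minus_add M.a_ac)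
    then show "p (x \<oplus>\<^bsub>M\<^esub> y) = p x \<oplus>\<^bsub>M\<^esub> p y"
      using x y p sub_add[OF K p(2)[OF x] p(2)[OF y]] sub_add[OF N] by (intro unique) auto
  next
    fix a x assume a: "a \<in> carrier R" and x: "x \<in> carrier M"
    then show "p (a \<odot>\<^bsub>M\<^esub> x) = a \<odot>\<^bsub>M\<^esub> p x"
      using p[OF x] mN sub_smult[OF K a p(2)[OF x]] sub_smult[OF N a]
      by (intro unique) (auto simp: smult_diff)
  qed (use p mN in \<open>auto simp: p_def\<close>)
  moreover have "p x = x" if "x \<in> N" for x
    using that mN sub_zero[OF K] by (intro unique) (auto simp: diff_eq_zero_iff[THEN iffD2])
  moreover have "p x = \<zero>\<^bsub>M\<^esub>" if "x \<in> K" for x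
    using that mK sub_zero[OF N] by (intro unique) (auto simp: diff_zero)
  ultimately show ?thesis using that p(1) by blast
qed

end

section \<open>The structure of co-semisimple Goldie modules\<close>

lemma ACC_left_annihilatorsD:
  assumes "ACC_left_annihilators R M" "\<And>i. left_annihilator_in R M (N i)"
    "\<And>i. N i \<subseteq> N (Suc i)"
  shows "\<exists>k. \<forall>i\<ge>k. N i = N k"
  using assms unfolding ACC_left_annihilators_def by simp

context left_module
begin

text \<open>The kernel of a single endomorphism is a left annihilator, so a sequence of strictly
  growing kernels obtained by dependent choice would violate the ACC.\<close>

lemma maximal_kernel:
  assumes acc: "ACC_left_annihilators R M" and "F \<noteq> {}" "F \<subseteq> E"
  obtains f where "f \<in> F" "\<And>g. g \<in> F \<Longrightarrow> a_kernel M M f \<subseteq> a_kernel M M g \<Longrightarrow> a_kernel M M g = a_kernel M M f"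
proof (rule ccontr)
  note found = that
  assume "\<not> thesis"
  then have step: "\<exists>g. g \<in> F \<and> a_kernel M M f \<subset> a_kernel M M g" if "f \<in> F" for f
    using that found[of f] by blast
  have "\<exists>s. \<forall>n. s n \<in> F \<and> a_kernel M M (s n) \<subset> a_kernel M M (s (Suc n))"
    using assms(2) step by (intro dependent_nat_choice) auto
  then obtain s :: "nat \<Rightarrow> 'b \<Rightarrow> 'b"
    where s: "\<And>n. s n \<in> F" "\<And>n. a_kernel M M (s n) \<subset> a_kernel M M (s (Suc n))" by blast
  have ann: "left_annihilator_in R M (a_kernel M M (s n))" for n
    unfolding left_annihilator_in_def
    using s(1)[of n] assms(3) by (intro exI[of _ "{s n}"]) (auto simp: mem_kernel_iff)
  have "\<exists>k. \<forall>i\<ge>k. a_kernel M M (s i) = a_kernel M M (s k)"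
    by (rule ACC_left_annihilatorsD[where N = "\<lambda>n. a_kernel M M (s n)", OF acc ann
          psubset_imp_subset[OF s(2)]])
  then obtain k where k: "\<forall>i\<ge>k. a_kernel M M (s i) = a_kernel M M (s k)" ..
  show False using s(2)[of k] k[rule_format, of "Suc k"] by simp
qed

text \<open>The restriction restores extensionality, which iteration does not preserve; already
  \<open>f ^^ 0\<close> is the identity on the whole type.\<close>

lemma E_funpow:
  assumes "f \<in> E" shows "(\<lambda>x\<in>carrier M. (f ^^ n) x) \<in> E"
proof (induction n)
  case 0
  show ?case by (rule lmod_homI) auto
next
  case (Suc n)
  have "(\<lambda>x\<in>carrier M. (f ^^ Suc n) x) = compose (carrier M) f (\<lambda>x\<in>carrier M. (f ^^ n) x)"
    by (auto simp: compose_def fun_eq_iff)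
  then show ?case using E_compose[OF assms Suc] by (simp only:)
qed

text \<open>The kernels of the powers of f form an ascending chain of left annihilators. Once it is
  stationary, the n-th and the 2n-th power have the same kernel.\<close>

lemma Fitting_power:
  assumes acc: "ACC_left_annihilators R M" and f: "f \<in> E"
  obtains n where "n > 0" "\<And>x. x \<in> carrier M \<Longrightarrow> (f ^^ n) ((f ^^ n) x) = \<zero>\<^bsub>M\<^esub> \<Longrightarrow> (f ^^ n) x = \<zero>\<^bsub>M\<^esub>"
proof -
  define K where "K n = {x \<in> carrier M. (f ^^ n) x = \<zero>\<^bsub>M\<^esub>}" for n
  have ann: "left_annihilator_in R M (K n)" for n
    unfolding left_annihilator_in_def using E_funpow[OF f, of n]
    by (intro exI[of _ "{\<lambda>x\<in>carrier M. (f ^^ n) x}"]) (auto simp: K_def mem_kernel_iff)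
  have chain: "K n \<subseteq> K (Suc n)" for n
    by (auto simp: K_def E_zero[OF f])
  have "\<exists>k. \<forall>i\<ge>k. K i = K k"
    by (rule ACC_left_annihilatorsD[where N = K, OF acc ann chain])
  then obtain k where k: "\<forall>i\<ge>k. K i = K k" ..
  show ?thesis
  \<comment> \<open>Taking \<open>Suc k\<close> instead of k makes the exponent positive, so that
    the power still maps into each submodule containing f(M).\<close>
  proof (rule that[of "Suc k"])
    fix x assume x: "x \<in> carrier M" "(f ^^ Suc k) ((f ^^ Suc k) x) = \<zero>\<^bsub>M\<^esub>"
    then have "x \<in> K (Suc k + Suc k)" unfolding K_def funpow_add by simp
    then show "(f ^^ Suc k) x = \<zero>\<^bsub>M\<^esub>"
      using k[rule_format, of "Suc k + Suc k"] k[rule_format, of "Suc k"] unfolding K_def by auto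
  qed simp
qed

section \<open>Monomorphisms into essential submodules and complements of fully invariant
  ones\<close>

context
  assumes proj: "projective_in_sigma R M" and cos: "co_semisimple R M"
    and acc: "ACC_left_annihilators R M"
begin

text \<open>If every endomorphism into \<open>K\<close> were nilpotent, one with maximal kernel would satisfy
  \<open>f h f = 0\<close> for all \<open>h\<close>, so that \<open>f(M)\<^sub>M f(M) = 0\<close>.\<close>

lemma exists_Fitting_endo:
  assumes K: "sub K" "K \<noteq> {\<zero>\<^bsub>M\<^esub>}"
  obtains f x where "f \<in> E" "f ` carrier M \<subseteq> K" "x \<in> carrier M" "f x \<noteq> \<zero>\<^bsub>M\<^esub>"
    "\<And>y. y \<in> carrier M \<Longrightarrow> f (f y) = \<zero>\<^bsub>M\<^esub> \<Longrightarrow> f y = \<zero>\<^bsub>M\<^esub>"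
proof (rule ccontr)
  note found = that
  assume contra: "\<not> thesis"
  have pow_mem: "(u ^^ n) x \<in> carrier M" if "u \<in> E" "x \<in> carrier M" for u n x
    using hom_mem[OF E_funpow[OF that(1)] that(2), of n] that(2) by simp
  \<comment> \<open>If u were not nilpotent, the power given by \<open>Fitting_power\<close> would
    be nonzero, would still map into K and would have the property assumed not to occur.\<close>
  have nil: "\<exists>n. \<forall>x\<in>carrier M. (u ^^ n) x = \<zero>\<^bsub>M\<^esub>" if u: "u \<in> E" "u ` carrier M \<subseteq> K" for u
  proof (rule ccontr)
    assume nn: "\<nexists>n. \<forall>x\<in>carrier M. (u ^^ n) x = \<zero>\<^bsub>M\<^esub>"
    obtain n where n: "n > 0"
      "\<And>x. x \<in> carrier M \<Longrightarrow> (u ^^ n) ((u ^^ n) x) = \<zero>\<^bsub>M\<^esub> \<Longrightarrow> (u ^^ n) x = \<zero>\<^bsub>M\<^esub>"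
      using Fitting_power[OF acc u(1)] by blast
    obtain x where x: "x \<in> carrier M" "(u ^^ n) x \<noteq> \<zero>\<^bsub>M\<^esub>" using nn by blast
    let ?g = "\<lambda>x\<in>carrier M. (u ^^ n) x"
    have "(u ^^ n) y \<in> K" if "y \<in> carrier M" for y
    proof -
      obtain m where "n = Suc m" using n(1) gr0_implies_Suc by blast
      then show ?thesis using u(2) pow_mem[OF u(1) that, of m] by auto
    qed
    then have "?g ` carrier M \<subseteq> K" by auto
    moreover have "?g x \<noteq> \<zero>\<^bsub>M\<^esub>" using x by simp
    moreover have "?g y = \<zero>\<^bsub>M\<^esub>" if "y \<in> carrier M" "?g (?g y) = \<zero>\<^bsub>M\<^esub>" for y
      using that n(2)[of y] pow_mem[OF u(1) that(1), of n] by simp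
    ultimately show False
      using contra found[OF E_funpow[OF u(1)]] x(1) by blast
  qed
  define F where "F = {f \<in> E. f ` carrier M \<subseteq> K \<and> (\<exists>x\<in>carrier M. f x \<noteq> \<zero>\<^bsub>M\<^esub>)}"
  obtain g x where "g \<in> E" "g ` carrier M \<subseteq> K" "x \<in> K" "g x \<noteq> \<zero>\<^bsub>M\<^esub>"
    by (rule co_semisimple_nonzero_endo[OF proj cos K])
  then have "g \<in> F" using sub_mem[OF K(1)] unfolding F_def by blast
  then have "F \<noteq> {}" by blast
  then obtain f where fF: "f \<in> F" and
    max: "\<And>g. g \<in> F \<Longrightarrow> a_kernel M M f \<subseteq> a_kernel M M g \<Longrightarrow> a_kernel M M g = a_kernel M M f"
    using maximal_kernel[OF acc, of F] unfolding F_def by blast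
  then have f: "f \<in> E" "f ` carrier M \<subseteq> K" by (auto simp: F_def)
  have fhf: "f (h (f x)) = \<zero>\<^bsub>M\<^esub>" if h: "h \<in> E" and x: "x \<in> carrier M" for h x
  proof (rule ccontr)
    assume nz: "f (h (f x)) \<noteq> \<zero>\<^bsub>M\<^esub>"
    define u where "u = compose (carrier M) f h"
    have u: "u \<in> E" unfolding u_def by (rule E_compose[OF f(1) h])
    have u_eq: "u y = f (h y)" if "y \<in> carrier M" for y using that by (simp add: u_def compose_def)
    have uK: "u ` carrier M \<subseteq> K" using f(2) E_mem[OF h] u_eq by auto
    have fM: "f y \<in> carrier M" if "y \<in> carrier M" for y using that by (rule E_mem[OF f(1)])
    \<comment> \<open>This contradicts nilpotency of u. In the inductive step, u^n after f is a
      nonzero map into K whose kernel contains that of f, so by maximality the kernels agree. Since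
      f does not kill h(f x), neither does u^n after f.\<close>
    have "(u ^^ n) (f x) \<noteq> \<zero>\<^bsub>M\<^esub>" for n
    proof (induction n)
      case 0
      show ?case using nz E_zero[OF f(1)] E_zero[OF h] by auto
    next
      case (Suc n)
      let ?\<phi> = "compose (carrier M) (\<lambda>y\<in>carrier M. (u ^^ n) y) f"
      have \<phi>: "?\<phi> y = (u ^^ n) (f y)" if "y \<in> carrier M" for y
        using that fM by (simp add: compose_def)
      have "(u ^^ n) (f y) \<in> K" if "y \<in> carrier M" for y
      proof (cases n)
        case 0
        then show ?thesis using f(2) that by auto
      next
        case (Suc m)
        then show ?thesis using uK pow_mem[OF u fM[OF that], of m] by auto
      qed
      then have "?\<phi> ` carrier M \<subseteq> K" using \<phi> by auto
      then have "?\<phi> \<in> F"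
        unfolding F_def using E_compose[OF E_funpow[OF u] f(1), of n] \<phi>[OF x] Suc x
        by (intro CollectI conjI bexI[of _ x]) (simp_all only: not_False_eq_True)
      moreover have "a_kernel M M f \<subseteq> a_kernel M M ?\<phi>"
        using E_zero[OF E_funpow[OF u], of n] by (auto simp: mem_kernel_iff \<phi>)
      ultimately have ker: "a_kernel M M ?\<phi> = a_kernel M M f" by (rule max)
      have hM: "h (f x) \<in> carrier M" using E_mem[OF h fM[OF x]] .
      then have "h (f x) \<notin> a_kernel M M ?\<phi>" using nz unfolding ker by (simp add: mem_kernel_iff)
      then have "(u ^^ n) (f (h (f x))) \<noteq> \<zero>\<^bsub>M\<^esub>" using hM \<phi>[OF hM] by (simp add: mem_kernel_iff)
      then show ?case using u_eq[OF fM[OF x]] by (simp add: funpow_swap1)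
    qed
    then show False using nil[OF u uK] fM[OF x] by blast
  qed
  define L where "L = f ` carrier M"
  have L: "sub L" unfolding L_def by (rule sub_image[OF f(1) sub_full])
  have "L \<noteq> {\<zero>\<^bsub>M\<^esub>}" using fF by (auto simp: F_def L_def)
  then obtain g y where g: "g \<in> E" "g ` carrier M \<subseteq> L" "y \<in> L" "g y \<noteq> \<zero>\<^bsub>M\<^esub>"
    by (rule co_semisimple_nonzero_endo[OF proj cos L])
  \<comment> \<open>By projectivity each map into f(M) has the form f after h, so on f(M) it acts
    through f h f = 0.\<close>
  obtain h where h: "h \<in> E" "h ` carrier M \<subseteq> carrier M" "\<And>z. z \<in> carrier M \<Longrightarrow> f (h z) = g z"
    by (rule projective_lift_along[OF proj sub_full f(1) g(1) g(2)[unfolded L_def]]) (rule that)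
  obtain x where x: "x \<in> carrier M" "y = f x" using g(3) by (auto simp: L_def)
  then have "g y = f (h (f x))" using h(3)[of y] E_mem[OF f(1)] by simp
  then show False using fhf[OF h(1) x(1)] g(4) by simp
qed

text \<open>While c has a nonzero kernel, that kernel meets N, and a map f into N \<inter> Ker c
  with Ker(f f) = Ker f is added to c. The submodule W, on which c is injective, grows by f(M), so d
  W measures progress. The property Ker(c c) = Ker c has to be carried along.\<close>

lemma essential_contains_mono_image:
  assumes rank: "rank_function R M d" and N: "essential_in R M N"
  obtains c where "c \<in> E" "c ` carrier M \<subseteq> N" "\<And>x. x \<in> carrier M \<Longrightarrow> c x = \<zero>\<^bsub>M\<^esub> \<Longrightarrow> x = \<zero>\<^bsub>M\<^esub>"
proof -
  have sN: "sub N" using N by (simp add: essential_in_def)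
  have "\<exists>c'\<in>E. c' ` carrier M \<subseteq> N \<and> (\<forall>x\<in>carrier M. c' x = \<zero>\<^bsub>M\<^esub> \<longrightarrow> x = \<zero>\<^bsub>M\<^esub>)"
    if "c \<in> E" "c ` carrier M \<subseteq> N" "\<And>x. x \<in> carrier M \<Longrightarrow> c (c x) = \<zero>\<^bsub>M\<^esub> \<Longrightarrow> c x = \<zero>\<^bsub>M\<^esub>"
      "sub W" "\<And>x. x \<in> W \<Longrightarrow> c x = \<zero>\<^bsub>M\<^esub> \<Longrightarrow> x = \<zero>\<^bsub>M\<^esub>" for c W
    using that
  proof (induction "d W" arbitrary: c W rule: less_induct)
    case less
    note c = less.prems(1-3) and W = less.prems(4,5)
    note mW = sub_mem[OF W(1)]
    show ?case
    proof (cases "a_kernel M M c = {\<zero>\<^bsub>M\<^esub>}")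
      case True
      then have "\<forall>x\<in>carrier M. c x = \<zero>\<^bsub>M\<^esub> \<longrightarrow> x = \<zero>\<^bsub>M\<^esub>" using mem_kernel_iff by blast
      then show ?thesis using c by blast
    next
      case False
      define K where "K = N \<inter> a_kernel M M c"
      have K: "sub K" unfolding K_def using sN sub_kernel[OF c(1)] by (rule sub_Int)
      have "K \<noteq> {\<zero>\<^bsub>M\<^esub>}"
        using N False sub_kernel[OF c(1)] unfolding K_def essential_in_def by blast
      then obtain f x where f: "f \<in> E" "f ` carrier M \<subseteq> K" and x: "x \<in> carrier M" "f x \<noteq> \<zero>\<^bsub>M\<^esub>"
        and ff: "\<And>y. y \<in> carrier M \<Longrightarrow> f (f y) = \<zero>\<^bsub>M\<^esub> \<Longrightarrow> f y = \<zero>\<^bsub>M\<^esub>"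
        using exists_Fitting_endo[OF K] by blast
      have cM: "c y \<in> carrier M" and fM: "f y \<in> carrier M" if "y \<in> carrier M" for y
        using that E_mem[OF c(1)] E_mem[OF f(1)] by auto
      have cf: "c (f y) = \<zero>\<^bsub>M\<^esub>" and fN: "f y \<in> N" if "y \<in> carrier M" for y
        using f(2) that by (auto simp: K_def mem_kernel_iff)
      define e where "e = (\<lambda>y\<in>carrier M. c y \<oplus>\<^bsub>M\<^esub> f y)"
      have e: "e \<in> E" unfolding e_def by (rule E_sum[OF c(1) f(1)])
      \<comment> \<open>Applying c removes the summand f y, as f maps into Ker c. The remaining c(c
        y) = 0 gives c y = 0, so Ker e is the intersection of Ker c and Ker f.\<close>
      have e_zero: "c y = \<zero>\<^bsub>M\<^esub> \<and> f y = \<zero>\<^bsub>M\<^esub>" if y: "y \<in> carrier M" "e y = \<zero>\<^bsub>M\<^esub>" for y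
      proof -
        have "e y = c y \<oplus>\<^bsub>M\<^esub> f y" using y by (simp add: e_def)
        then have "c (e y) = c (c y) \<oplus>\<^bsub>M\<^esub> c (f y)"
          using E_add[OF c(1) cM[OF y(1)] fM[OF y(1)]] by (simp only:)
        then have "c (c y) = \<zero>\<^bsub>M\<^esub>" using y cf cM E_zero[OF c(1)] by simp
        then have "c y = \<zero>\<^bsub>M\<^esub>" using c(3) y by blast
        then show ?thesis using y fM by (simp add: e_def)
      qed
      define V where "V = f ` carrier M"
      have V: "sub V" unfolding V_def by (rule sub_image[OF f(1) sub_full])
      have "V \<noteq> {\<zero>\<^bsub>M\<^esub>}" using x by (auto simp: V_def)
      moreover have "V \<inter> W = {\<zero>\<^bsub>M\<^esub>}"
        using W(2) cf by (intro sub_eq_trivialI sub_Int V W(1)) (auto simp: V_def)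
      ultimately have "d (V <+>\<^bsub>M\<^esub> W) < d W" using rank_functionD[OF rank V W(1)] by blast
      moreover have "e ` carrier M \<subseteq> N"
        using c(2) fN sub_add[OF sN] by (auto simp: e_def image_subset_iff)
      \<comment> \<open>From e(e y) = 0 both c and f kill e y. The first gives c y = 0, thus e y = f
        y; the second then reads f(f y) = 0.\<close>
      moreover have "e y = \<zero>\<^bsub>M\<^esub>" if y: "y \<in> carrier M" "e (e y) = \<zero>\<^bsub>M\<^esub>" for y
      proof -
        have ey: "e y = c y \<oplus>\<^bsub>M\<^esub> f y" using y by (simp add: e_def)
        have z: "c (e y) = \<zero>\<^bsub>M\<^esub>" "f (e y) = \<zero>\<^bsub>M\<^esub>" using e_zero[OF E_mem[OF e y(1)] y(2)] by auto
        then have "c (c y) = \<zero>\<^bsub>M\<^esub>" using y cM fM cf by (simp add: ey E_add[OF c(1)])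
        then have cy: "c y = \<zero>\<^bsub>M\<^esub>" using c(3) y by blast
        have "e y = f y" using ey cy fM[OF y(1)] by simp
        then show ?thesis using z(2) ff[OF y(1)] by simp
      qed
      moreover have "w = \<zero>\<^bsub>M\<^esub>" if w: "w \<in> V <+>\<^bsub>M\<^esub> W" "e w = \<zero>\<^bsub>M\<^esub>" for w
      proof -
        obtain y w' where yw: "y \<in> carrier M" "w' \<in> W" "w = f y \<oplus>\<^bsub>M\<^esub> w'"
          using w(1) by (auto simp: V_def elim!: set_addE)
        have wM: "w \<in> carrier M" using yw fM mW by simp
        have z: "c w = \<zero>\<^bsub>M\<^esub>" "f w = \<zero>\<^bsub>M\<^esub>" using e_zero[OF wM w(2)] by auto
        then have "c w' = \<zero>\<^bsub>M\<^esub>" using yw fM mW cM cf by (simp add: E_add[OF c(1)])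
        then have w': "w = f y" using W(2)[OF yw(2)] yw fM by simp
        then show ?thesis using z(2) ff yw(1) by simp
      qed
      ultimately show ?thesis using less.hyps[OF _ e _ _ sub_set_add[OF V W(1)]] by blast
    qed
  qed
  \<comment> \<open>The start is c = 0 and W = 0, where both conditions hold trivially.\<close>
  from this[OF E_null _ _ sub_trivial] obtain c where
    "c \<in> E" "c ` carrier M \<subseteq> N" "\<forall>x\<in>carrier M. c x = \<zero>\<^bsub>M\<^esub> \<longrightarrow> x = \<zero>\<^bsub>M\<^esub>"
    using sub_zero[OF sN] by auto
  then show ?thesis using that by blast
qed

text \<open>With \<open>c : M \<rightarrow> N\<close> injective and \<open>L = c(M)\<close>, invariance of \<open>N\<close> gives \<open>L = L\<^sub>M L \<subseteq> c(N)\<close>.\<close>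

lemma essential_fully_invariant_eq:
  assumes rank: "rank_function R M d" and ess: "essential_in R M N"
    and FI: "fully_invariant R M N"
  shows "N = carrier M"
proof
  have N: "sub N" using FI by (rule fully_invariantD)
  then show "N \<subseteq> carrier M" by (rule sub_carrier)
  obtain c where c: "c \<in> E" "c ` carrier M \<subseteq> N"
    and inj: "\<And>x. x \<in> carrier M \<Longrightarrow> c x = \<zero>\<^bsub>M\<^esub> \<Longrightarrow> x = \<zero>\<^bsub>M\<^esub>"
    using essential_contains_mono_image[OF rank ess] by blast
  have "c ` carrier M \<subseteq> c ` N"
  proof (rule co_semisimple_subset[OF proj cos])
    show "sub (c ` carrier M)" "sub (c ` N)" using c(1) sub_full N by (auto intro: sub_image)
    fix g assume g: "g \<in> E" "g ` carrier M \<subseteq> c ` carrier M"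
    obtain h where h: "h \<in> E" "h ` carrier M \<subseteq> carrier M" "\<And>x. x \<in> carrier M \<Longrightarrow> c (h x) = g x"
      by (rule projective_lift_along[OF proj sub_full c(1) g]) (rule that)
    show "g ` c ` carrier M \<subseteq> c ` N"
    proof (rule subsetI, elim imageE, hypsubst)
      fix x assume "x \<in> carrier M"
      then have "c x \<in> N" "c x \<in> carrier M" using c E_mem by blast+
      \<comment> \<open>Here g(c x) = c(h(c x)), and h(c x) stays in N by full invariance.\<close>
      then show "g (c x) \<in> c ` N"
        using h(3)[of "c x"] fully_invariantD(2)[OF FI h(1), of "c x"] by (intro image_eqI[of _ _ "h (c x)"]) simp_all
    qed
  qed
  show "carrier M \<subseteq> N"
  proof
    fix x assume x: "x \<in> carrier M"
    then obtain y where y: "y \<in> N" "c x = c y" using \<open>c ` carrier M \<subseteq> c ` N\<close> by blast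
    then have yM: "y \<in> carrier M" using sub_mem[OF N] by blast
    have "c (x \<ominus>\<^bsub>M\<^esub> y) = \<zero>\<^bsub>M\<^esub>"
      using x y yM E_mem[OF c(1)] by (simp add: E_diff[OF c(1)] diff_eq_zero_iff[THEN iffD2])
    then have "x \<ominus>\<^bsub>M\<^esub> y = \<zero>\<^bsub>M\<^esub>" using inj x yM by blast
    then show "x \<in> N" using diff_eq_zero_iff[OF x yM] y(1) by blast
  qed
qed

text \<open>A map from M into the intersection is a map into N, so it kills the intersection, which
  lies in the annihilator. The intersection thus has zero square, and semiprimeness applies.\<close>

lemma hom_annihilator_Int:
  assumes N: "sub N" shows "N \<inter> hom_annihilator N = {\<zero>\<^bsub>M\<^esub>}"
proof (rule ccontr)
  have "sub (N \<inter> hom_annihilator N)"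
    by (intro sub_Int N fully_invariantD(1)[OF fully_invariant_hom_annihilator])
  moreover assume "N \<inter> hom_annihilator N \<noteq> {\<zero>\<^bsub>M\<^esub>}"
  ultimately obtain g x where
    "g \<in> E" "g ` carrier M \<subseteq> N \<inter> hom_annihilator N" "x \<in> N \<inter> hom_annihilator N" "g x \<noteq> \<zero>\<^bsub>M\<^esub>"
    using co_semisimple_nonzero_endo[OF proj cos] by blast
  then show False using hom_annihilatorD[of x N g] by blast
qed

text \<open>Essentiality holds because each A with A \<inter> N = 0 lies in the annihilator. If some
  f : M -> N does not kill A, semiprimeness yields g into f(A) with g y nonzero for some y in f(A).
  Lifting gives g = f h with h : M -> A; but y is in N, so h y lies in N \<inter> A = 0.\<close>

lemma fully_invariant_complement:
  assumes rank: "rank_function R M d" and FI: "fully_invariant R M N"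
  shows "N <+>\<^bsub>M\<^esub> hom_annihilator N = carrier M"
proof (rule essential_fully_invariant_eq[OF rank])
  let ?K = "hom_annihilator N"
  have N: "sub N" using FI by (rule fully_invariantD)
  have FK: "fully_invariant R M ?K" by (rule fully_invariant_hom_annihilator)
  then have K: "sub ?K" by (rule fully_invariantD)
  show "fully_invariant R M (N <+>\<^bsub>M\<^esub> ?K)" by (rule fully_invariant_set_add[OF FI FK])
  show "essential_in R M (N <+>\<^bsub>M\<^esub> ?K)"
    unfolding essential_in_def
  proof (intro conjI allI impI notI)
    show "sub (N <+>\<^bsub>M\<^esub> ?K)" by (rule sub_set_add[OF N K])
    fix A assume "sub A \<and> A \<noteq> {\<zero>\<^bsub>M\<^esub>}" and triv: "(N <+>\<^bsub>M\<^esub> ?K) \<inter> A = {\<zero>\<^bsub>M\<^esub>}"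
    then have A: "sub A" "A \<noteq> {\<zero>\<^bsub>M\<^esub>}" by auto
    have NA: "x = \<zero>\<^bsub>M\<^esub>" if "x \<in> N" "x \<in> A" for x
      using triv that set_add_upper1[OF N K] by blast
    have "A \<subseteq> ?K"
    proof
      fix a assume a: "a \<in> A"
      have "f a = \<zero>\<^bsub>M\<^esub>" if f: "f \<in> E" "f ` carrier M \<subseteq> N" for f
      proof (rule ccontr)
        assume "f a \<noteq> \<zero>\<^bsub>M\<^esub>"
        then have "f ` A \<noteq> {\<zero>\<^bsub>M\<^esub>}" using a by blast
        then obtain g y where g: "g \<in> E" "g ` carrier M \<subseteq> f ` A" "y \<in> f ` A" "g y \<noteq> \<zero>\<^bsub>M\<^esub>"
          by (rule co_semisimple_nonzero_endo[OF proj cos sub_image[OF f(1) A(1)]])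
        obtain h where h: "h \<in> E" "h ` carrier M \<subseteq> A" "\<And>x. x \<in> carrier M \<Longrightarrow> f (h x) = g x"
          by (rule projective_lift_along[OF proj A(1) f(1) g(1,2)]) (rule that)
        have y: "y \<in> N" "y \<in> carrier M" using g(3) f(2) sub_mem[OF A(1)] sub_mem[OF N] by blast+
        then have "h y = \<zero>\<^bsub>M\<^esub>" using NA fully_invariantD(2)[OF FI h(1)] h(2) by blast
        then show False using h(3)[OF y(2)] g(4) E_zero[OF f(1)] by simp
      qed
      then show "a \<in> ?K" using a sub_mem[OF A(1)] by (simp add: hom_annihilator_def)
    qed
    then show False using A triv set_add_upper2[OF N K] sub_zero[OF A(1)] by blast
  qed
qed

lemma fully_invariant_projection:
  assumes "rank_function R M d" "fully_invariant R M N"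
  obtains p where "p \<in> E" "p ` carrier M \<subseteq> N" "\<And>x. x \<in> N \<Longrightarrow> p x = x"
    "\<And>x. x \<in> hom_annihilator N \<Longrightarrow> p x = \<zero>\<^bsub>M\<^esub>"
  using projection_exists[OF fully_invariantD(1)[OF assms(2)]
      fully_invariantD(1)[OF fully_invariant_hom_annihilator]
      hom_annihilator_Int[OF fully_invariantD(1)[OF assms(2)]] fully_invariant_complement[OF assms]]
  by blast

end

section \<open>Splitting off minimal fully invariant submodules\<close>

definition minimal_FI :: "'b set \<Rightarrow> bool" where
  "minimal_FI N \<longleftrightarrow> fully_invariant R M N \<and> N \<noteq> {\<zero>\<^bsub>M\<^esub>} \<and>
     (\<forall>K. fully_invariant R M K \<and> K \<subseteq> N \<longrightarrow> K = {\<zero>\<^bsub>M\<^esub>} \<or> K = N)"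

text \<open>The maps \<open>p i\<close> induce an isomorphism of \<open>M/W\<close> with the product of the \<open>N i\<close>, \<open>i < n\<close>.\<close>

definition FI_decomposition :: "'b set \<Rightarrow> nat \<Rightarrow> (nat \<Rightarrow> 'b set) \<Rightarrow> (nat \<Rightarrow> 'b \<Rightarrow> 'b) \<Rightarrow> bool" where
  "FI_decomposition W n N p \<longleftrightarrow>
    (\<forall>i<n. minimal_FI (N i) \<and> p i \<in> E \<and> p i ` carrier M \<subseteq> N i) \<and>
    (\<forall>x\<in>carrier M. (\<forall>i<n. p i x = \<zero>\<^bsub>M\<^esub>) \<longleftrightarrow> x \<in> W) \<and>
    (\<forall>y. (\<forall>i<n. y i \<in> N i) \<longrightarrow> (\<exists>x\<in>carrier M. \<forall>i<n. p i x = y i))"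

lemma
  assumes "FI_decomposition W n N p"
  shows FI_decomposition_hom: "i < n \<Longrightarrow> minimal_FI (N i) \<and> p i \<in> E \<and> p i ` carrier M \<subseteq> N i"
    and FI_decomposition_kernel: "x \<in> carrier M \<Longrightarrow> (\<forall>i<n. p i x = \<zero>\<^bsub>M\<^esub>) \<longleftrightarrow> x \<in> W"
    and FI_decomposition_surj: "(\<And>i. i < n \<Longrightarrow> y i \<in> N i) \<Longrightarrow> \<exists>x\<in>carrier M. \<forall>i<n. p i x = y i"
  using assms unfolding FI_decomposition_def by blast+

context
  fixes d :: "'b set \<Rightarrow> nat"
  assumes proj: "projective_in_sigma R M" and cos: "co_semisimple R M"
    and acc: "ACC_left_annihilators R M" and rank: "rank_function R M d"
begin

lemmas FI_complement = fully_invariant_complement[OF proj cos acc rank]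
  and FI_annihilator_Int = hom_annihilator_Int[OF proj cos acc]

text \<open>The descent of \<open>rank_imp_uniform_submodule\<close> with fully invariant pieces: a
  smaller B inside A is moved into W, and its annihilator within A takes over the role of A.\<close>

lemma minimal_FI_exists:
  assumes "sub W" "fully_invariant R M A" "A \<noteq> {\<zero>\<^bsub>M\<^esub>}" "A \<inter> W = {\<zero>\<^bsub>M\<^esub>}"
  shows "\<exists>V\<subseteq>A. minimal_FI V"
  using assms
proof (induction "d W" arbitrary: W A rule: less_induct)
  case less
  note W = less.prems(1) and A = less.prems(2) and A_nz = less.prems(3) and AW = less.prems(4)
  have sA: "sub A" using A by (rule fully_invariantD)
  show ?case
  proof (cases "minimal_FI A")
    case False
    then obtain B where B: "fully_invariant R M B" "B \<subseteq> A" "B \<noteq> {\<zero>\<^bsub>M\<^esub>}" "B \<noteq> A"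
      using A A_nz unfolding minimal_FI_def by blast
    have sB: "sub B" using B(1) by (rule fully_invariantD)
    define C where "C = hom_annihilator B \<inter> A"
    have C: "fully_invariant R M C"
      unfolding C_def by (rule fully_invariant_Int[OF fully_invariant_hom_annihilator A])
    have sC: "sub C" using C by (rule fully_invariantD)
    have BC: "x = \<zero>\<^bsub>M\<^esub>" if "x \<in> B" "x \<in> C" for x
      using that FI_annihilator_Int[OF sB] by (auto simp: C_def)
    \<comment> \<open>By the modular law A is the sum of B and C, so C = 0 would make A equal to
      B.\<close>
    have "C \<noteq> {\<zero>\<^bsub>M\<^esub>}"
    proof
      assume C0: "C = {\<zero>\<^bsub>M\<^esub>}"
      have "A \<subseteq> B"
      proof
        fix a assume a: "a \<in> A"
        then have "a \<in> B <+>\<^bsub>M\<^esub> hom_annihilator B" using FI_complement[OF B(1)] sub_mem[OF sA] by blast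
        then obtain b c where bc: "b \<in> B" "c \<in> hom_annihilator B" "a = b \<oplus>\<^bsub>M\<^esub> c"
          by (rule set_addE)
        have cM: "c \<in> carrier M" using bc(2) by (simp add: hom_annihilator_def)
        then have "c \<in> A" using sub_add_cancel_left[OF sA _ cM, of b] bc a B(2) by blast
        then have "c = \<zero>\<^bsub>M\<^esub>" using bc(2) C0 by (auto simp: C_def)
        then show "a \<in> B" using bc sub_mem[OF sB] by simp
      qed
      then show False using B by blast
    qed
    moreover have "d (B <+>\<^bsub>M\<^esub> W) < d W"
      using B(2) AW sub_zero[OF sB] sub_zero[OF W]
      by (intro rank_functionD[OF rank] sB W B(3)) blast
    moreover have BW: "sub (B <+>\<^bsub>M\<^esub> W)" using sB W by (rule sub_set_add)
    moreover have "C \<inter> (B <+>\<^bsub>M\<^esub> W) = {\<zero>\<^bsub>M\<^esub>}"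
    proof (rule sub_eq_trivialI)
      show "sub (C \<inter> (B <+>\<^bsub>M\<^esub> W))" using sC BW by (rule sub_Int)
      fix c assume c: "c \<in> C \<inter> (B <+>\<^bsub>M\<^esub> W)"
      then obtain b w where bw: "b \<in> B" "w \<in> W" "c = b \<oplus>\<^bsub>M\<^esub> w" by (auto elim!: set_addE)
      then have "w \<in> A"
        using sub_add_cancel_left[OF sA, of b w] B(2) c sub_mem[OF W] by (auto simp: C_def)
      then have "w = \<zero>\<^bsub>M\<^esub>" using Int_trivialD[OF AW] bw by blast
      then have "c = b" using bw sub_mem[OF sB] by simp
      then show "c = \<zero>\<^bsub>M\<^esub>" using BC bw c by blast
    qed
    ultimately obtain V where "V \<subseteq> C" "minimal_FI V"
      using less.hyps[of "B <+>\<^bsub>M\<^esub> W" C] C by blast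
    then show ?thesis by (auto simp: C_def)
  qed blast
qed

text \<open>Only W = 0 is wanted in the end, but the induction runs upward through larger W until W
  = M, where no factor remains. A decomposition of M/(V + W) becomes one of M/W by adjoining the
  projection onto V.\<close>

lemma FI_decomposition_exists:
  assumes "fully_invariant R M W"
  shows "\<exists>n N p. FI_decomposition W n N p"
  using assms
proof (induction "d W" arbitrary: W rule: less_induct)
  case less
  note W = less.prems
  have sW: "sub W" using W by (rule fully_invariantD)
  show ?case
  proof (cases "W = carrier M")
    case True
    then have "FI_decomposition W 0 N p" for N p by (auto simp: FI_decomposition_def)
    then show ?thesis by blast
  next
    case False
    let ?K = "hom_annihilator W"
    have K: "fully_invariant R M ?K" by (rule fully_invariant_hom_annihilator)
    have "?K \<noteq> {\<zero>\<^bsub>M\<^esub>}"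
    proof
      assume K0: "?K = {\<zero>\<^bsub>M\<^esub>}"
      have "carrier M \<subseteq> W"
        unfolding FI_complement[OF W, symmetric] K0 using sub_zero[OF sW]
        by (intro set_add_least[OF sW]) auto
      then show False using False sub_carrier[OF sW] by blast
    qed
    then obtain V where V: "V \<subseteq> ?K" "minimal_FI V"
      using minimal_FI_exists[OF sW K] FI_annihilator_Int[OF sW] by (auto simp: Int_commute)
    then have FV: "fully_invariant R M V" "V \<noteq> {\<zero>\<^bsub>M\<^esub>}" by (auto simp: minimal_FI_def)
    have sV: "sub V" using FV(1) by (rule fully_invariantD)
    have VW: "V \<inter> W = {\<zero>\<^bsub>M\<^esub>}"
      using V(1) FI_annihilator_Int[OF sW] sub_zero[OF sV] sub_zero[OF sW] by blast
    obtain \<pi> where \<pi>: "\<pi> \<in> E" "\<pi> ` carrier M \<subseteq> V" "\<And>x. x \<in> V \<Longrightarrow> \<pi> x = x"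
      "\<And>x. x \<in> hom_annihilator V \<Longrightarrow> \<pi> x = \<zero>\<^bsub>M\<^esub>"
      by (rule fully_invariant_projection[OF proj cos acc rank FV(1)]) (rule that)
    \<comment> \<open>W lies in the annihilator of V: for f : M -> V the element f w is in V, and in
      W by invariance, hence 0.\<close>
    have \<pi>W: "\<pi> w = \<zero>\<^bsub>M\<^esub>" if w: "w \<in> W" for w
    proof (rule \<pi>(4))
      have wM: "w \<in> carrier M" using w sub_mem[OF sW] by blast
      have "f w = \<zero>\<^bsub>M\<^esub>" if f: "f \<in> E" "f ` carrier M \<subseteq> V" for f
        using Int_trivialD[OF VW, of "f w"] f wM fully_invariantD(2)[OF W f(1) w] by blast
      then show "w \<in> hom_annihilator V" using wM by (simp add: hom_annihilator_def)
    qed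
    have "d (V <+>\<^bsub>M\<^esub> W) < d W" by (rule rank_functionD[OF rank sV sW FV(2) VW])
    then obtain n N p where D: "FI_decomposition (V <+>\<^bsub>M\<^esub> W) n N p"
      using less.hyps[OF _ fully_invariant_set_add[OF FV(1) W]] by blast
    note Np = FI_decomposition_hom[OF D] and ker = FI_decomposition_kernel[OF D]
      and surj = FI_decomposition_surj[OF D]
    let ?N = "N(n := V)" and ?p = "p(n := \<pi>)"
    have all: "(\<forall>i<Suc n. P i (?p i)) \<longleftrightarrow> (\<forall>i<n. P i (p i)) \<and> P n \<pi>" for P
      by (auto simp: less_Suc_eq)
    have "FI_decomposition W (Suc n) ?N ?p"
      unfolding FI_decomposition_def
    proof (intro conjI ballI allI impI)
      fix i assume "i < Suc n"
      then show "minimal_FI (?N i)" "?p i \<in> E" "?p i ` carrier M \<subseteq> ?N i"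
        using Np[of i] V(2) \<pi>(1,2) by (auto simp: less_Suc_eq)
    next
      fix x assume x: "x \<in> carrier M"
      have "x \<in> V <+>\<^bsub>M\<^esub> W \<and> \<pi> x = \<zero>\<^bsub>M\<^esub> \<longleftrightarrow> x \<in> W"
      proof
        assume *: "x \<in> V <+>\<^bsub>M\<^esub> W \<and> \<pi> x = \<zero>\<^bsub>M\<^esub>"
        then obtain v w where vw: "v \<in> V" "w \<in> W" "x = v \<oplus>\<^bsub>M\<^esub> w" by (auto elim!: set_addE)
        then have "\<pi> x = v"
          using \<pi>W \<pi>(3) sub_mem[OF sV] sub_mem[OF sW] by (simp add: E_add[OF \<pi>(1)])
        then show "x \<in> W" using vw * sub_mem[OF sW] by simp
      next
        assume "x \<in> W"
        then show "x \<in> V <+>\<^bsub>M\<^esub> W \<and> \<pi> x = \<zero>\<^bsub>M\<^esub>" using \<pi>W set_add_upper2[OF sV sW] by blast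
      qed
      then show "(\<forall>i<Suc n. ?p i x = \<zero>\<^bsub>M\<^esub>) \<longleftrightarrow> x \<in> W"
        using all[of "\<lambda>i f. f x = \<zero>\<^bsub>M\<^esub>"] ker[OF x] by simp
    next
      fix y :: "nat \<Rightarrow> 'b" assume y: "\<forall>i<Suc n. y i \<in> ?N i"
      then have yn: "y n \<in> V" and "\<And>i. i < n \<Longrightarrow> y i \<in> N i" by (auto simp: less_Suc_eq)
      then obtain x where x: "x \<in> carrier M" "\<forall>i<n. p i x = y i" using surj by blast
      \<comment> \<open>A correction term for the last component. The other maps \<open>p i\<close>
        kill it, since it lies in V and they vanish on V + W.\<close>
      define v where "v = y n \<ominus>\<^bsub>M\<^esub> \<pi> x"
      have v: "v \<in> V" unfolding v_def using yn \<pi>(2) x by (intro sub_diff[OF sV]) auto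
      have vM: "v \<in> carrier M" using v sub_mem[OF sV] by blast
      have pv: "p i v = \<zero>\<^bsub>M\<^esub>" if "i < n" for i
        using ker[OF vM] v set_add_upper1[OF sV sW] that by blast
      have "p i (v \<oplus>\<^bsub>M\<^esub> x) = y i" if "i < n" for i
      proof -
        have "p i \<in> E" using Np that by blast
        then show ?thesis
          using pv[OF that] x that vM E_mem[of "p i" x] by (simp add: E_add)
      qed
      moreover have "\<pi> (v \<oplus>\<^bsub>M\<^esub> x) = y n"
        using x vM \<pi>(3)[OF v] yn sub_mem[OF sV] E_mem[OF \<pi>(1)]
        by (simp add: E_add[OF \<pi>(1)]) (simp add: v_def diff_add_cancel)
      ultimately have "\<forall>i<Suc n. ?p i (v \<oplus>\<^bsub>M\<^esub> x) = y i"
        using all[of "\<lambda>i f. f (v \<oplus>\<^bsub>M\<^esub> x) = y i"] by simp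
      then show "\<exists>x\<in>carrier M. \<forall>i<Suc n. ?p i x = y i" using x vM by blast
    qed
    then show ?thesis by blast
  qed
qed

text \<open>Uniform dimension is inherited through the rank function. For the ACC, an annihilator of
  a set Y in N is pulled back along the projection to the annihilator in M of the maps f after the
  projection, f in Y; intersecting with N recovers it.\<close>

lemma minimal_FI_Goldie:
  assumes N: "minimal_FI N"
  shows "Goldie_lmod R (M\<lparr>carrier := N\<rparr>)"
proof -
  let ?X = "M\<lparr>carrier := N\<rparr>"
  have FN: "fully_invariant R M N" using N by (simp add: minimal_FI_def)
  then have sN: "sub N" by (rule fully_invariantD)
  interpret X: left_module R ?X by (rule submodule_left_module[OF sN])
  have dim: "\<exists>n. has_uniform_dimension R ?X n"
    by (rule X.rank_imp_uniform_dimension[OF rank_function_submodule[OF rank sN]])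
  obtain \<pi> where \<pi>: "\<pi> \<in> E" "\<pi> ` carrier M \<subseteq> N" "\<And>x. x \<in> N \<Longrightarrow> \<pi> x = x"
    "\<And>x. x \<in> hom_annihilator N \<Longrightarrow> \<pi> x = \<zero>\<^bsub>M\<^esub>"
    by (rule fully_invariant_projection[OF proj cos acc rank FN]) (rule that)
  have \<pi>X: "\<pi> \<in> lmod_hom R M ?X" using \<pi> hom_to_submodule_iff[OF sN] by blast
  have "ACC_left_annihilators R ?X"
    unfolding ACC_left_annihilators_def
  proof (intro allI impI, elim conjE)
    fix A :: "nat \<Rightarrow> 'b set"
    assume ann: "\<forall>i. left_annihilator_in R ?X (A i)" and chain: "\<forall>i. A i \<subseteq> A (Suc i)"
    define B where "B i = {x \<in> carrier M. \<pi> x \<in> A i}" for i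
    have AN: "A i \<subseteq> N" for i using ann by (force simp: left_annihilator_in_def)
    have annB: "left_annihilator_in R M (B i)" for i
    proof -
      obtain Y where Y: "Y \<subseteq> lmod_End R ?X" "A i = carrier ?X \<inter> (\<Inter>f\<in>Y. a_kernel ?X ?X f)"
        using ann[rule_format, of i] unfolding left_annihilator_in_def by (elim exE conjE) (rule that)
      have "compose (carrier M) f \<pi> \<in> E" if f: "f \<in> Y" for f
      proof -
        have "f \<in> lmod_hom R ?X ?X" using f Y(1) by (rule subsetD[rotated])
        then have "compose (carrier M) f \<pi> \<in> lmod_hom R M ?X"
          by (rule hom_compose[OF is_left_module \<pi>X])
        then show ?thesis by (simp only: hom_to_submodule_iff[OF sN])
      qed
      then have "(\<lambda>f. compose (carrier M) f \<pi>) ` Y \<subseteq> E" by (rule image_subsetI)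
      moreover have "B i = carrier M \<inter> (\<Inter>f\<in>(\<lambda>f. compose (carrier M) f \<pi>) ` Y. a_kernel M M f)"
      proof -
        have "\<pi> x \<in> A i \<longleftrightarrow> (\<forall>f\<in>Y. f (\<pi> x) = \<zero>\<^bsub>M\<^esub>)" if "x \<in> carrier M" for x
          using \<pi>(2) that by (simp add: Y(2) X.mem_kernel_iff image_subset_iff)
        then show ?thesis by (auto simp: B_def mem_kernel_iff compose_def)
      qed
      ultimately show ?thesis unfolding left_annihilator_in_def by (intro exI conjI)
    qed
    have chainB: "B i \<subseteq> B (Suc i)" for i using chain by (auto simp: B_def)
    have AB: "A i = B i \<inter> N" for i
      using AN[of i] \<pi>(3) sub_mem[OF sN] by (auto simp: B_def)
    have "\<exists>k. \<forall>i\<ge>k. B i = B k" by (rule ACC_left_annihilatorsD[where N = B, OF acc annB chainB])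
    then obtain k where k: "\<forall>i\<ge>k. B i = B k" ..
    have "A i = A k" if "i \<ge> k" for i
      using k[rule_format, OF that] AB[of i] AB[of k] by (simp only:)
    then show "\<exists>k. \<forall>i\<ge>k. A i = A k" by blast
  qed
  with dim show ?thesis by (simp add: Goldie_lmod_def)
qed

end

text \<open>Endomorphisms of M restrict to N, so a submodule invariant under the endomorphisms of N
  is fully invariant in M, and minimality of N applies.\<close>

lemma minimal_FI_imp_FI_simple:
  assumes N: "minimal_FI N" shows "FI_simple R (M\<lparr>carrier := N\<rparr>)"
  unfolding FI_simple_def
proof (intro allI impI)
  let ?X = "M\<lparr>carrier := N\<rparr>"
  fix K assume K: "fully_invariant R ?X K"
  have FN: "fully_invariant R M N" using N by (simp add: minimal_FI_def)
  note sN = fully_invariantD(1)[OF FN]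
  have sK: "sub K" "K \<subseteq> N"
    using K submodule_submodule_iff[OF sN] by (auto simp: fully_invariant_def)
  have "f ` K \<subseteq> K" if f: "f \<in> E" for f
  proof -
    have "restrict f N \<in> lmod_End R ?X"
      using fully_invariantD(2)[OF FN f] sub_add[OF sN] sub_smult[OF sN] sub_mem[OF sN]
      by (intro lmod_homI) (auto simp: E_add[OF f] E_smult[OF f])
    then have "restrict f N ` K \<subseteq> K" using K unfolding fully_invariant_def by blast
    then show ?thesis using sK(2) by (auto simp: image_subset_iff)
  qed
  then have "fully_invariant R M K" using sK(1) by (simp add: fully_invariant_def)
  then show "K = {\<zero>\<^bsub>?X\<^esub>} \<or> K = carrier ?X" using N sK(2) by (simp add: minimal_FI_def)
qed

text \<open>Two nonzero fully invariant submodules both equal M, and their product contains the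
  image of the identity.\<close>

lemma FI_simple_imp_prime:
  assumes "FI_simple R M" "carrier M \<noteq> {\<zero>\<^bsub>M\<^esub>}" shows "prime_lmod R M"
  unfolding prime_lmod_def prime_in_def
proof (intro conjI allI impI; (elim conjE)?)
  show "fully_invariant R M {\<zero>\<^bsub>M\<^esub>}" by (rule fully_invariant_trivial)
  show "{\<zero>\<^bsub>M\<^esub>} \<noteq> carrier M" using assms(2) by blast
  fix N K assume N: "fully_invariant R M N" and K: "fully_invariant R M K"
    and NK: "submodule_product R M N K \<subseteq> {\<zero>\<^bsub>M\<^esub>}"
  show "N \<subseteq> {\<zero>\<^bsub>M\<^esub>} \<or> K \<subseteq> {\<zero>\<^bsub>M\<^esub>}"
  proof (rule ccontr)
    assume "\<not> ?thesis"
    then have eq: "N = carrier M" "K = carrier M" using assms(1) N K by (auto simp: FI_simple_def)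
    have "(\<lambda>x\<in>carrier M. x) \<in> lmod_hom R M (M\<lparr>carrier := K\<rparr>)"
      unfolding eq by (rule lmod_homI) auto
    then have "(\<lambda>x\<in>carrier M. x) ` N \<subseteq> submodule_product R M N K"
      unfolding submodule_product_def by (intro submodule_sum_upper) blast
    then have "carrier M \<subseteq> {\<zero>\<^bsub>M\<^esub>}" using NK unfolding eq by (auto simp: image_subset_iff)
    then show False using assms(2) M.zero_closed by blast
  qed
qed

end

theorem corollary4p10:
  fixes R :: "'a ring" and M :: "('a, 'm) module"
  assumes "left_module R M"
    and "projective_in_sigma R M"
    and "co_semisimple R M"
    and "Goldie_lmod R M"
  shows "\<exists>(n :: nat) (N :: nat \<Rightarrow> ('a, 'm) module).
    (\<forall>i<n. left_module R (N i) \<and> FI_simple R (N i) \<and> prime_lmod R (N i) \<and> Goldie_lmod R (N i)) \<and>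
    lmod_isomorphic R M (lmod_product {..<n} N)"
proof -
  interpret left_module R M by fact
  have acc: "ACC_left_annihilators R M" using assms(4) by (simp add: Goldie_lmod_def)
  obtain d where rank: "rank_function R M d"
    using assms(4) uniform_dimension_imp_rank unfolding Goldie_lmod_def by blast
  \<comment> \<open>With W = 0 the common kernel of the maps \<open>p i\<close> is zero, so together
    they embed M into the product; the decomposition also makes them jointly surjective.\<close>
  obtain n N p where D: "FI_decomposition {\<zero>\<^bsub>M\<^esub>} n N p"
    using FI_decomposition_exists[OF assms(2,3) acc rank fully_invariant_trivial] by blast
  note Np = FI_decomposition_hom[OF D] and ker = FI_decomposition_kernel[OF D]
    and surj = FI_decomposition_surj[OF D]
  define X where "X i = M\<lparr>carrier := N i\<rparr>" for i
  have "left_module R (X i) \<and> FI_simple R (X i) \<and> prime_lmod R (X i) \<and> Goldie_lmod R (X i)"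
    if "i < n" for i
  proof -
    have min: "minimal_FI (N i)" using Np that by blast
    then have "sub (N i)" "N i \<noteq> {\<zero>\<^bsub>M\<^esub>}" by (auto simp: minimal_FI_def fully_invariant_def)
    then have X: "left_module R (X i)" "carrier (X i) \<noteq> {\<zero>\<^bsub>X i\<^esub>}"
      unfolding X_def by (auto intro: submodule_left_module)
    have simple: "FI_simple R (X i)" unfolding X_def by (rule minimal_FI_imp_FI_simple[OF min])
    have "prime_lmod R (X i)" by (rule left_module.FI_simple_imp_prime[OF X(1) simple X(2)])
    moreover have "Goldie_lmod R (X i)"
      unfolding X_def by (rule minimal_FI_Goldie[OF assms(2,3) acc rank min])
    ultimately show ?thesis using X simple by blast
  qed
  moreover have "lmod_isomorphic R M (lmod_product {..<n} X)"
    unfolding lmod_isomorphic_def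
  proof (rule bexI)
    let ?f = "\<lambda>x\<in>carrier M. \<lambda>i\<in>{..<n}. p i x"
    have p: "p i \<in> E" "x \<in> carrier M \<Longrightarrow> p i x \<in> N i" if "i < n" for i x
      using Np[OF that] by auto
    show "?f \<in> lmod_hom R M (lmod_product {..<n} X)"
      using p by (intro lmod_homI)
        (auto simp: lmod_product_def X_def fun_eq_iff E_add E_smult)
    show "bij_betw ?f (carrier M) (carrier (lmod_product {..<n} X))"
      unfolding bij_betw_def
    proof
      show "inj_on ?f (carrier M)"
      proof (rule inj_onI)
        fix x y assume xy: "x \<in> carrier M" "y \<in> carrier M" and eq: "?f x = ?f y"
        have "p i (x \<ominus>\<^bsub>M\<^esub> y) = \<zero>\<^bsub>M\<^esub>" if i: "i < n" for i
        proof -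
          have "p i x = p i y" using fun_cong[OF eq, of i] xy i by simp
          then show ?thesis
            using xy E_mem[OF p(1)[OF i]] by (simp add: E_diff[OF p(1)[OF i]] diff_eq_zero_iff)
        qed
        then have "x \<ominus>\<^bsub>M\<^esub> y = \<zero>\<^bsub>M\<^esub>" using ker[of "x \<ominus>\<^bsub>M\<^esub> y"] xy by simp
        then show "x = y" using diff_eq_zero_iff xy by blast
      qed
      show "?f ` carrier M = carrier (lmod_product {..<n} X)"
      proof
        show "?f ` carrier M \<subseteq> carrier (lmod_product {..<n} X)"
          using p(2) by (auto simp: lmod_product_def X_def split: if_splits)
        show "carrier (lmod_product {..<n} X) \<subseteq> ?f ` carrier M"
        proof
          fix y assume y: "y \<in> carrier (lmod_product {..<n} X)"
          then have "y i \<in> N i" if "i < n" for i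
            using that by (auto simp: lmod_product_def X_def)
          then obtain x where x: "x \<in> carrier M" "\<forall>i<n. p i x = y i" using surj by blast
          \<comment> \<open>Elements of the product are extensional, so equality of functions also
            needs agreement outside the index set.\<close>
          moreover have "y i = undefined" if "\<not> i < n" for i
            using y that by (auto simp: lmod_product_def PiE_def extensional_def)
          ultimately have "y = ?f x" by (auto simp: fun_eq_iff)
          then show "y \<in> ?f ` carrier M" using x(1) by blast
        qed
      qed
    qed
  qed
  ultimately show ?thesis by blast
qed

end
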